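(* Let $\varphi$ be a strongly convex function that satisfies the $\Delta_2$-condition and the $\nabla_2$-condition. If $u$ is a non-negative Borel function on the unit disk $\mathbb{D}$, then the following are equivalent: (a) There exists a function $w\in L^\varphi(\mathbb{T})$ such that $u(z)\le P[w](z)$ for all $z\in\mathbb{D}$. (b) There exists a constant $C\ge0$ such that $\sup_{\mu\in\mathcal{B}_{\varphi^*}}\int u(z)\,d\mu(z)\le C$, where $\mathcal{B}_{\varphi^*}$ is the set of positive measures $\mu$ on $\mathbb{D}$ with $\|B(\mu)\|_{(L^\varphi)^*}\le1$.
   Context: A function $\varphi:\mathbb{R}\to[0,\infty)$ is strongly convex if it is convex, nondecreasing, $\lim_{t\to\infty}\varphi(t)/t=\infty$, and there are constants $M,K\ge0$, $t_0\in\mathbb{R}$ with $\varphi(t+2)\le M\varphi(t)+K$ for $t\ge t_0$. $\Delta_2$-condition: there are $c\ge1$, $t_0$ with $\varphi(a+b)\le c(\varphi(a)+\varphi(b))$ for all $a,b\ge t_0$. $\nabla_2$-condition: there are $d>1$, $t_0>0$ with $2\varphi(t)\le\frac1d\varphi(dt)$ for $t\ge t_0$. $L^\varphi(\mathbb{T})$ is the Orlicz space of measurable $u$ on $\mathbb{T}$ with $\varphi\circ|u|\in L^1(m)$ ($m$ normalized Lebesgue measure); $\varphi$ is modified on some $[0,t_0]$ to a convex function on $[0,\infty)$ vanishing at $0$, $L^\varphi$ carries the Banach norm $\|u\|_\varphi=\inf\{t>0:\int\varphi(|u|/t)dm\le t\}$, and $(L^\varphi)^*$ is its dual with dual norm.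 $P_z(\zeta)=\frac{1-|z|^2}{|\zeta-z|^2}$, $P[w](z)=\int_{\mathbb{T}}P_z w\,dm$. The Poisson balayage of a finite positive measure $\mu$ is $B(\mu)(\zeta)=\int_{\mathbb{D}}P_z(\zeta)\,d\mu(z)$, $\zeta\in\mathbb{T}$. *)

theory Defs
  imports "HOL-Analysis.Analysis"
begin

definition strongly_convex :: "(real \<Rightarrow> real) \<Rightarrow> bool" where
  "strongly_convex \<phi> \<longleftrightarrow>
     (\<forall>t. 0 \<le> \<phi> t) \<and> convex_on UNIV \<phi> \<and> mono \<phi> \<and>
     filterlim (\<lambda>t. \<phi> t / t) at_top at_top \<and>
     (\<exists>M K t0. 0 \<le> M \<and> 0 \<le> K \<and> (\<forall>t\<ge>t0. \<phi> (t + 2) \<le> M * \<phi> t + K))"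

definition Delta2 :: "(real \<Rightarrow> real) \<Rightarrow> bool" where
  "Delta2 \<phi> \<longleftrightarrow> (\<exists>c\<ge>1. \<exists>t0. \<forall>a b. t0 \<le> a \<longrightarrow> t0 \<le> b \<longrightarrow> \<phi> (a + b) \<le> c * (\<phi> a + \<phi> b))"

definition Nabla2 :: "(real \<Rightarrow> real) \<Rightarrow> bool" where
  "Nabla2 \<phi> \<longleftrightarrow> (\<exists>d>1. \<exists>t0>0. \<forall>t\<ge>t0. 2 * \<phi> t \<le> (1 / d) * \<phi> (d * t))"

definition modification_of :: "(real \<Rightarrow> real) \<Rightarrow> (real \<Rightarrow> real) \<Rightarrow> bool" where
  "modification_of \<psi> \<phi> \<longleftrightarrow>
     convex_on {0..} \<psi> \<and> \<psi> 0 = 0 \<and> (\<forall>t\<ge>0. 0 \<le> \<psi> t) \<and>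
     (\<exists>t0\<ge>0. \<forall>t\<ge>t0. \<psi> t = \<phi> t)"

definition circle_measure :: "complex measure" where
  "circle_measure = distr (density (restrict_space lborel {0..2*pi}) (\<lambda>_. ennreal (1 / (2*pi))))
                          borel (\<lambda>\<theta>. cis \<theta>)"

definition orlicz_space :: "(real \<Rightarrow> real) \<Rightarrow> (complex \<Rightarrow> real) set" where
  "orlicz_space \<phi> = {w. w \<in> borel_measurable circle_measure \<and>
                          integrable circle_measure (\<lambda>\<zeta>. \<phi> \<bar>w \<zeta>\<bar>)}"

definition orlicz_norm :: "(real \<Rightarrow> real) \<Rightarrow> (complex \<Rightarrow> real) \<Rightarrow> real" where
  "orlicz_norm \<psi> w = Inf {t. 0 < t \<and> (\<integral>\<^sup>+ \<zeta>. ennreal (\<psi> (\<bar>w \<zeta>\<bar> / t)) \<partial>circle_measure) \<le> ennreal t}"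

definition dual_norm_le_one :: "(real \<Rightarrow> real) \<Rightarrow> (real \<Rightarrow> real) \<Rightarrow> (complex \<Rightarrow> real) \<Rightarrow> bool" where
  "dual_norm_le_one \<phi> \<psi> g \<longleftrightarrow>
     (\<forall>w \<in> orlicz_space \<phi>. integrable circle_measure (\<lambda>\<zeta>. g \<zeta> * w \<zeta>)) \<and>
     (\<forall>w \<in> orlicz_space \<phi>. orlicz_norm \<psi> w \<le> 1 \<longrightarrow>
        \<bar>\<integral> \<zeta>. g \<zeta> * w \<zeta> \<partial>circle_measure\<bar> \<le> 1)"

definition poisson_kernel :: "complex \<Rightarrow> complex \<Rightarrow> real" where
  "poisson_kernel z \<zeta> = (1 - (cmod z)\<^sup>2) / (cmod (\<zeta> - z))\<^sup>2"

definition poisson_integral :: "(complex \<Rightarrow> real) \<Rightarrow> complex \<Rightarrow> real" where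
  "poisson_integral w z = (\<integral> \<zeta>. poisson_kernel z \<zeta> * w \<zeta> \<partial>circle_measure)"

definition balayage :: "complex measure \<Rightarrow> complex \<Rightarrow> real" where
  "balayage \<mu> \<zeta> = (\<integral> z. poisson_kernel z \<zeta> \<partial>\<mu>)"

definition disc_measures :: "complex measure set" where
  "disc_measures = {\<mu>. sets \<mu> = sets borel \<and> finite_measure \<mu> \<and>
                        emeasure \<mu> (UNIV - ball 0 1) = 0}"

definition B_phi_star :: "(real \<Rightarrow> real) \<Rightarrow> (real \<Rightarrow> real) \<Rightarrow> complex measure set" where
  "B_phi_star \<phi> \<psi> = {\<mu> \<in> disc_measures. dual_norm_le_one \<phi> \<psi> (balayage \<mu>)}"

end

theory Submission
  imports Defs "HOL-Complex_Analysis.Cauchy_Integral_Formula"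
begin

text \<open>
  (a) implies (b) by Tonelli, since integrating \<open>P[w]\<close> against \<open>\<mu>\<close> is pairing \<open>w\<close> with the balayage of
  \<open>\<mu>\<close>; as \<open>\<integral> P\<^sub>z dm = 1\<close>, the balayage is finite almost everywhere.

  For the converse let \<open>K\<close> be the convex set of \<open>v \<ge> 0\<close> with \<open>\<integral> \<psi>(v) dm \<le> 2\<close>. Testing (b) on finite
  combinations of point masses and separating in finite dimension yields, for finitely many points
  \<open>z\<^sub>i\<close> and any \<open>\<epsilon> > 0\<close>, some \<open>v \<in> K\<close> with \<open>u(z\<^sub>i) - \<epsilon> \<le> 2C P[v](z\<^sub>i)\<close>. Weak compactness of \<open>K\<close> is
  replaced by a Komlos-type argument: nearly minimising \<open>\<integral> exp(-v) dm\<close> over the decreasing convex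
  sets of such \<open>v\<close> produces an almost everywhere convergent sequence, and the superlinear growth of
  \<open>\<psi>\<close> makes the limit satisfy the constraints at countably many points. Choosing these points
  dense in the graph of \<open>u\<close> and using continuity of \<open>P[v]\<close> gives the inequality on the whole disc;
  \<open>\<Delta>\<^sub>2\<close> ensures that \<open>2Cv\<close> lies in \<open>L\<^sup>\<phi>\<close>.
\<close>

section \<open>Separation in finite dimension\<close>

text \<open>In the proof \<open>G a\<close> is the squared distance from \<open>a\<close> to the
  orthant of points dominating \<open>b\<close>. At a near-minimiser the positive part of
  \<open>b - a\<close> almost separates \<open>A\<close> from that orthant, and \<open>dual\<close>
  turns this into a bound on \<open>G a\<close> itself. Near-minimisers replace compactness of
  \<open>A\<close>, which is why the conclusion loses \<open>\<epsilon>\<close>.\<close>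

lemma coordinatewise_dominated_if_dual_bound:
  fixes A :: "(nat \<Rightarrow> real) set" and b :: "nat \<Rightarrow> real" and B \<epsilon> :: real
  assumes ne: "A \<noteq> {}"
    and conv: "\<And>a a' t. a \<in> A \<Longrightarrow> a' \<in> A \<Longrightarrow> 0 \<le> t \<Longrightarrow> t \<le> 1 \<Longrightarrow> (\<lambda>i. (1 - t) * a i + t * a' i) \<in> A"
    and bnd: "\<And>a i. a \<in> A \<Longrightarrow> i < n \<Longrightarrow> 0 \<le> a i \<and> a i \<le> B"
    and dual: "\<And>l S. (\<And>i. 0 \<le> l i) \<Longrightarrow> 0 \<le> S \<Longrightarrow> (\<And>a. a \<in> A \<Longrightarrow> (\<Sum>i<n. l i * a i) \<le> S)
      \<Longrightarrow> (\<Sum>i<n. l i * b i) \<le> S"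
    and eps: "0 < \<epsilon>"
  shows "\<exists>a\<in>A. \<forall>i<n. b i - \<epsilon> \<le> a i"
proof -
  define G where "G a = (\<Sum>i<n. (max 0 (b i - a i))\<^sup>2)" for a
  define \<delta> where "\<delta> = Inf (G ` A)"
  have G0: "0 \<le> G a" for a unfolding G_def by (intro sum_nonneg) simp
  have bdd: "bdd_below (G ` A)" using G0 by (intro bdd_belowI[of _ 0]) auto
  have \<delta>le: "\<delta> \<le> G a" if "a \<in> A" for a
    unfolding \<delta>_def using bdd that by (auto intro: cInf_lower)
  have near: "\<exists>a\<in>A. G a < \<delta> + s" if "0 < s" for s
    using cInf_lessD[of "G ` A" "\<delta> + s"] ne that unfolding \<delta>_def by auto
  have "\<delta> \<le> 0"
  proof (rule ccontr)
    assume "\<not> \<delta> \<le> 0"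
    then have \<delta>: "0 < \<delta>" by simp
    define M where "M = n * B\<^sup>2"
    have M0: "0 \<le> M" by (simp add: M_def)
    \<comment> \<open>The step length makes \<open>t * (1 + M) / 2\<close>, the error of the
      variational inequality below, at most half of \<open>\<delta>\<close>. The excess
      \<open>t\<^sup>2\<close> over the infimum allowed for \<open>a\<close> has the order of the
      quadratic term \<open>t\<^sup>2 * M\<close>.\<close>
    define t where "t = min 1 (\<delta> / (1 + M))"
    have t: "0 < t" "t \<le> 1" using \<delta> M0 by (auto simp: t_def)
    have "t * (1 + M) \<le> \<delta> / (1 + M) * (1 + M)"
      using M0 by (intro mult_right_mono) (auto simp: t_def)
    then have tM: "t * (1 + M) \<le> \<delta>" using M0 by simp
    obtain a where a: "a \<in> A" "G a < \<delta> + t\<^sup>2" using near[of "t\<^sup>2"] t by auto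
    define l where "l i = max 0 (b i - a i)" for i
    have var: "(\<Sum>i<n. l i * (a' i - a i)) \<le> t * (1 + M) / 2" if a': "a' \<in> A" for a'
    proof -
      let ?c = "\<lambda>i. (1 - t) * a i + t * a' i"
      \<comment> \<open>The squared positive part is bounded by its first-order expansion, with
        derivative \<open>2 * max 0 x\<close>, plus a quadratic remainder.\<close>
      have pos: "(max 0 (x - s))\<^sup>2 \<le> (max 0 x)\<^sup>2 - 2 * (max 0 x) * s + s\<^sup>2" for x s :: real
      proof -
        have "(max 0 x)\<^sup>2 - 2 * (max 0 x) * s + s\<^sup>2 = (max 0 x - s)\<^sup>2"
          by (simp add: power2_diff)
        moreover have "\<bar>max 0 (x - s)\<bar> \<le> \<bar>max 0 x - s\<bar>" by (simp add: max_def)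
        ultimately show ?thesis by (metis abs_le_square_iff)
      qed
      have "\<delta> \<le> G ?c" using \<delta>le conv[OF a(1) a'] t by simp
      also have "\<dots> \<le> (\<Sum>i<n. (l i)\<^sup>2 - 2 * t * (l i * (a' i - a i)) + t\<^sup>2 * B\<^sup>2)"
        unfolding G_def
      proof (intro sum_mono)
        fix i assume "i \<in> {..<n}"
        then have i: "i < n" by simp
        have "\<bar>a' i - a i\<bar> \<le> \<bar>B\<bar>" using bnd[OF a(1) i] bnd[OF a' i] by linarith
        then have "(a' i - a i)\<^sup>2 \<le> B\<^sup>2" by (simp only: abs_le_square_iff)
        then have sq: "(t * (a' i - a i))\<^sup>2 \<le> t\<^sup>2 * B\<^sup>2"
          by (simp add: mult_left_mono power_mult_distrib)
        have "b i - ?c i = (b i - a i) - t * (a' i - a i)" by (simp add: algebra_simps)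
        then have "(max 0 (b i - ?c i))\<^sup>2 \<le> (l i)\<^sup>2 - 2 * l i * (t * (a' i - a i)) + (t * (a' i - a i))\<^sup>2"
          using pos[of "b i - a i" "t * (a' i - a i)"] by (simp only: l_def)
        also have "\<dots> \<le> (l i)\<^sup>2 - 2 * l i * (t * (a' i - a i)) + t\<^sup>2 * B\<^sup>2"
          using sq by (rule add_left_mono)
        also have "2 * l i * (t * (a' i - a i)) = 2 * t * (l i * (a' i - a i))" by simp
        finally show "(max 0 (b i - ?c i))\<^sup>2 \<le> (l i)\<^sup>2 - 2 * t * (l i * (a' i - a i)) + t\<^sup>2 * B\<^sup>2" .
      qed
      also have "\<dots> = G a - 2 * t * (\<Sum>i<n. l i * (a' i - a i)) + t\<^sup>2 * M"
        by (simp add: G_def l_def M_def sum.distrib sum_subtractf sum_distrib_left)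
      finally have "2 * t * (\<Sum>i<n. l i * (a' i - a i)) \<le> t * (t * (1 + M))"
        using a(2) by (simp add: algebra_simps power2_eq_square)
      then have "t * (2 * (\<Sum>i<n. l i * (a' i - a i))) \<le> t * (t * (1 + M))"
        by (simp add: algebra_simps)
      then show ?thesis using t(1) by simp
    qed
    have "(\<Sum>i<n. l i * b i) \<le> (\<Sum>i<n. l i * a i) + t * (1 + M) / 2"
    proof (rule dual)
      show "0 \<le> (\<Sum>i<n. l i * a i) + t * (1 + M) / 2"
        using bnd[OF a(1)] t M0 by (intro add_nonneg_nonneg sum_nonneg) (auto simp: l_def)
    next
      fix a' assume "a' \<in> A"
      from var[OF this] show "(\<Sum>i<n. l i * a' i) \<le> (\<Sum>i<n. l i * a i) + t * (1 + M) / 2"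
        by (simp add: right_diff_distrib sum_subtractf)
    qed (simp add: l_def)
    \<comment> \<open>Since \<open>max 0 y * y = (max 0 y)\<^sup>2\<close>, pairing the weights
      \<open>l\<close> with \<open>b - a\<close> recovers \<open>G a\<close>.\<close>
    moreover have "G a = (\<Sum>i<n. l i * b i) - (\<Sum>i<n. l i * a i)"
      unfolding G_def sum_subtractf[symmetric] l_def
      by (intro sum.cong refl) (simp add: max_def power2_eq_square algebra_simps)
    ultimately show False using \<delta>le[OF a(1)] tM \<delta> by linarith
  qed
  then obtain a where a: "a \<in> A" "G a < \<epsilon>\<^sup>2" using near[of "\<epsilon>\<^sup>2"] eps by fastforce
  have "b i - \<epsilon> \<le> a i" if "i < n" for i
  proof -
    have "(max 0 (b i - a i))\<^sup>2 \<le> G a"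
      unfolding G_def using that by (intro member_le_sum) auto
    with a(2) have "(max 0 (b i - a i))\<^sup>2 < \<epsilon>\<^sup>2" by simp
    then have "max 0 (b i - a i) < \<epsilon>" by (rule power_less_imp_less_base) (use eps in simp)
    then show ?thesis by simp
  qed
  with a(1) show ?thesis by blast
qed

section \<open>Almost everywhere convergence from convexity\<close>

lemma integrable_nonneg_le:
  fixes f g :: "'a \<Rightarrow> real"
  assumes g: "integrable M g" and f: "f \<in> borel_measurable M" and "\<And>x. 0 \<le> f x" "\<And>x. f x \<le> g x"
  shows "integrable M f"
  using g f
proof (rule Bochner_Integration.integrable_bound)
  show "AE x in M. norm (f x) \<le> norm (g x)"
    using order_trans[OF assms(4) abs_ge_self] assms(3) by (intro AE_I2) simp
qed

text \<open>The integral of \<open>exp (- f)\<close> is bounded without any integrability of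
  \<open>f\<close>. Its infima over the shrinking sets increase and converge, so strict convexity
  makes near-minimisers close: their \<open>exp (- f / 2)\<close> are Cauchy in L2, hence in L1, and
  a subsequence is Cauchy almost everywhere. This still allows \<open>f\<close> to tend to
  infinity.\<close>

lemma (in finite_measure) decreasing_convex_sets_AE_Cauchy:
  fixes K :: "nat \<Rightarrow> ('a \<Rightarrow> real) set"
  assumes ne: "\<And>n. K n \<noteq> {}"
    and dec: "\<And>m n. m \<le> n \<Longrightarrow> K n \<subseteq> K m"
    and mid: "\<And>n f g. f \<in> K n \<Longrightarrow> g \<in> K n \<Longrightarrow> (\<lambda>x. (f x + g x) / 2) \<in> K n"
    and meas: "\<And>n f. f \<in> K n \<Longrightarrow> f \<in> borel_measurable M"
    and nn: "\<And>n f x. f \<in> K n \<Longrightarrow> 0 \<le> f x"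
  obtains f r where "\<And>n. f n \<in> K n" "strict_mono (r :: nat \<Rightarrow> nat)"
    "AE x in M. Cauchy (\<lambda>n. exp (- f (r n) x / 2))"
proof -
  define J where "J f = (\<integral>x. exp (- f x) \<partial>M)" for f :: "'a \<Rightarrow> real"
  define I where "I n = Inf (J ` K n)" for n
  have int: "integrable M (\<lambda>x. exp (- (c * f x)))" if "f \<in> K n" "0 \<le> c" for f n c
    using that meas[OF that(1)] nn[OF that(1)]
    by (intro integrable_const_bound[where B=1]) auto
  have int1: "integrable M (\<lambda>x. exp (- f x))" if "f \<in> K n" for f n
    using int[OF that, of 1] by simp
  have J0: "0 \<le> J f" for f unfolding J_def by (intro integral_nonneg_AE) simp
  have bdd: "bdd_below (J ` K n)" for n using J0 by (intro bdd_belowI[of _ 0]) auto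
  have Ile: "I n \<le> J f" if "f \<in> K n" for n f
    unfolding I_def using bdd that by (auto intro: cInf_lower)
  have Jle: "J f \<le> measure M (space M)" if "f \<in> K n" for n f
  proof -
    have "J f \<le> (\<integral>x. 1 \<partial>M)"
      unfolding J_def using int1[OF that] nn[OF that] by (intro integral_mono) auto
    then show ?thesis by simp
  qed
  have Iinc: "I m \<le> I n" if "m \<le> n" for m n
    unfolding I_def using ne bdd dec[OF that] by (intro cInf_superset_mono) auto
  have "I n \<le> measure M (space M)" for n
    using ne[of n] Ile Jle by (meson ex_in_conv order_trans)
  moreover have "0 \<le> I n" for n
    unfolding I_def using ne J0 by (intro cInf_greatest) auto
  ultimately have "convergent I"
    using Iinc by (intro Bseq_monoseq_convergent BseqI'[where K="measure M (space M)"])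
      (auto simp: monoseq_def)
  then have Cau: "Cauchy I" by (simp add: Cauchy_convergent_iff)
  have "\<exists>f. f \<in> K n \<and> J f < I n + 1 / Suc n" for n
    using cInf_lessD[of "J ` K n" "I n + 1 / Suc n"] ne unfolding I_def by auto
  then obtain f where f: "\<And>n. f n \<in> K n" "\<And>n. J (f n) < I n + 1 / Suc n" by metis
  define h where "h n x = exp (- f n x / 2)" for n x
  have inth: "integrable M (h n)" for n
    using int[OF f(1), of "1/2" n] by (simp add: h_def[abs_def])
  have h01: "0 \<le> h n x" "h n x \<le> 1" for n x using nn[OF f(1)] by (auto simp: h_def)
  \<comment> \<open>The defect of midpoint convexity of \<open>exp (- t)\<close> is an exact square.\<close>
  have key: "(\<integral>x. (h m x - h n x)\<^sup>2 \<partial>M) \<le> (I n - I m) + 2 / Suc m" if "m \<le> n" for m n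
  proof -
    \<comment> \<open>For \<open>m \<le> n\<close> the later function still competes in
      \<open>K m\<close>, so the value of \<open>J\<close> at the midpoint is at least
      \<open>I m\<close>.\<close>
    have fn: "f n \<in> K m" using f(1)[of n] dec[OF that] by auto
    have mi: "(\<lambda>x. (f m x + f n x) / 2) \<in> K m" using mid f(1) fn by blast
    have "(h m x - h n x)\<^sup>2 = exp (- f m x) + exp (- f n x) - 2 * exp (- ((f m x + f n x) / 2))" for x
      by (simp add: h_def power2_eq_square algebra_simps add_divide_distrib flip: exp_add)
    then have "(\<integral>x. (h m x - h n x)\<^sup>2 \<partial>M) = J (f m) + J (f n) - 2 * J (\<lambda>x. (f m x + f n x) / 2)"
      unfolding J_def using int1[OF f(1)[of m]] int1[OF fn] int1[OF mi] by simp
    also have "\<dots> \<le> (I m + 1 / Suc m) + (I n + 1 / Suc n) - 2 * I m"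
      using f(2)[of m] f(2)[of n] Ile[OF mi] by linarith
    also have "\<dots> \<le> (I n - I m) + 2 / Suc m"
    proof -
      have "1 / real (Suc n) \<le> 1 / Suc m" using that by (intro divide_left_mono) auto
      then show ?thesis by simp
    qed
    finally show ?thesis .
  qed
  have intd: "integrable M (\<lambda>x. (h m x - h n x)\<^sup>2)" for m n
  proof (rule integrable_const_bound[where B=1])
    have "\<bar>h m x - h n x\<bar> \<le> 1" for x using h01[of m x] h01[of n x] by linarith
    then have "(h m x - h n x)\<^sup>2 \<le> 1" for x using abs_square_le_1 by blast
    then show "AE x in M. norm ((h m x - h n x)\<^sup>2) \<le> 1" by simp
  qed (use inth in measurable)
  have L1: "\<exists>N. \<forall>i\<ge>N. \<forall>j\<ge>N. (\<integral>x. norm (h i x - h j x) \<partial>M) < e" if e: "0 < e" for e :: real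
  proof -
    \<comment> \<open>Adding one keeps \<open>V\<close> positive even if the measure vanishes. The
      product \<open>s * V\<close> will be half of \<open>e\<close>; the other half comes from the
      integral of the square.\<close>
    define V where "V = measure M (space M) + 1"
    have V: "0 < V" "measure M (space M) < V" by (auto simp: V_def intro: add_nonneg_pos)
    define s where "s = e / (2 * V)"
    have s: "0 < s" using e V by (simp add: s_def)
    obtain N1 where N1: "\<And>m n. m \<ge> N1 \<Longrightarrow> n \<ge> N1 \<Longrightarrow> norm (I m - I n) < s * e / 4"
      using Cau e s unfolding Cauchy_iff by (meson divide_pos_pos mult_pos_pos zero_less_numeral)
    obtain N2 :: nat where N2: "8 / (s * e) < N2" using reals_Archimedean2 by blast
    have half: "(\<integral>x. norm (h i x - h j x) \<partial>M) < e" if ij: "max N1 N2 \<le> i" "i \<le> j" for i j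
    proof -
      have "8 / (s * e) < Suc i" using N2 ij by linarith
      then have "2 / real (Suc i) < s * e / 4" using e s by (simp add: field_simps)
      moreover have "\<bar>I j - I i\<bar> < s * e / 4" using N1[of j i] ij by simp
      ultimately have sq: "(\<integral>x. (h i x - h j x)\<^sup>2 \<partial>M) < s * e / 2"
        using key[OF ij(2)] by linarith
      \<comment> \<open>A weighted Young inequality takes the place of Cauchy-Schwarz in passing
        from squares to absolute values.\<close>
      have young: "\<bar>y\<bar> \<le> s + y\<^sup>2 / s" for y :: real
      proof -
        have "0 \<le> (\<bar>y\<bar> - s)\<^sup>2 + \<bar>y\<bar> * s" using s by simp
        then have "\<bar>y\<bar> * s \<le> s * s + y\<^sup>2" by (simp add: power2_diff power2_eq_square algebra_simps)
        then show ?thesis using s by (simp add: field_simps)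
      qed
      have "(\<integral>x. norm (h i x - h j x) \<partial>M) \<le> (\<integral>x. s + (h i x - h j x)\<^sup>2 / s \<partial>M)"
        using inth intd young by (intro integral_mono) auto
      also have "\<dots> = s * measure M (space M) + (\<integral>x. (h i x - h j x)\<^sup>2 \<partial>M) / s"
        using intd by simp
      also have "\<dots> < s * V + (s * e / 2) / s"
        using sq V s by (intro add_strict_mono mult_strict_left_mono divide_strict_right_mono) auto
      also have "\<dots> = e" using s V by (simp add: s_def)
      finally show ?thesis .
    qed
    have "(\<integral>x. norm (h i x - h j x) \<partial>M) < e" if "max N1 N2 \<le> i" "max N1 N2 \<le> j" for i j
      using half[of i j] half[of j i] that by (cases "i \<le> j") (auto simp: abs_minus_commute)
    then show ?thesis by blast
  qed
  obtain r where "strict_mono r" "AE x in M. Cauchy (\<lambda>i. h (r i) x)"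
    using cauchy_L1_AE_cauchy_subseq[OF inth L1] by blast
  with f(1) show thesis by (intro that[of f r]) (auto simp: h_def)
qed

section \<open>Normalised arc length and the Poisson kernel\<close>

lemma sets_circle_measure [measurable_cong, simp]: "sets circle_measure = sets borel"
  and space_circle_measure [simp]: "space circle_measure = UNIV"
  by (simp_all add: circle_measure_def)

lemma cis_measurable [measurable]: "cis \<in> borel_measurable borel"
  by (intro borel_measurable_continuous_onI continuous_intros)

lemma nn_integral_circle_measure:
  assumes [measurable]: "f \<in> borel_measurable borel"
  shows "(\<integral>\<^sup>+ \<zeta>. f \<zeta> \<partial>circle_measure) = ennreal (1 / (2*pi)) * (\<integral>\<^sup>+ \<theta>. f (cis \<theta>) * indicator {0..2*pi} \<theta> \<partial>lborel)"
proof -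
  have "(\<integral>\<^sup>+ \<zeta>. f \<zeta> \<partial>circle_measure)
      = (\<integral>\<^sup>+ \<theta>. ennreal (1 / (2*pi)) * f (cis \<theta>) \<partial>restrict_space lborel {0..2*pi})"
    unfolding circle_measure_def
    by (subst nn_integral_distr) (auto simp: nn_integral_density measurable_restrict_space1)
  also have "\<dots> = (\<integral>\<^sup>+ \<theta>. ennreal (1 / (2*pi)) * (f (cis \<theta>) * indicator {0..2*pi} \<theta>) \<partial>lborel)"
    by (subst nn_integral_restrict_space) (auto simp: mult.assoc)
  also have "\<dots> = ennreal (1 / (2*pi)) * (\<integral>\<^sup>+ \<theta>. f (cis \<theta>) * indicator {0..2*pi} \<theta> \<partial>lborel)"
    by (intro nn_integral_cmult) measurable
  finally show ?thesis .
qed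

lemma emeasure_circle_measure: "emeasure circle_measure UNIV = 1"
  using nn_integral_circle_measure[of "\<lambda>_. 1"]
  by (simp add: ennreal_mult[symmetric] del: ennreal_1)

interpretation circle: finite_measure circle_measure
  by standard (simp add: emeasure_circle_measure)

lemma AE_circle_norm: "AE \<zeta> in circle_measure. cmod \<zeta> = 1"
  unfolding circle_measure_def
  by (subst AE_distr_iff) (auto simp: measurable_restrict_space1)

lemma poisson_kernel_measurable [measurable (raw)]:
  assumes [measurable]: "f \<in> borel_measurable M" "g \<in> borel_measurable M"
  shows "(\<lambda>x. poisson_kernel (f x) (g x)) \<in> borel_measurable M"
  unfolding poisson_kernel_def by measurable

lemma poisson_kernel_nonneg: "z \<in> ball 0 1 \<Longrightarrow> 0 \<le> poisson_kernel z \<zeta>"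
  unfolding poisson_kernel_def by (simp add: abs_square_le_1)

lemma poisson_kernel_le:
  assumes "cmod z \<le> \<rho>" "\<rho> < 1" "cmod \<zeta> = 1"
  shows "poisson_kernel z \<zeta> \<le> 1 / (1 - \<rho>)\<^sup>2"
proof -
  have "1 - \<rho> \<le> cmod (\<zeta> - z)" using norm_triangle_ineq2[of \<zeta> z] assms by simp
  then have "(1 - \<rho>)\<^sup>2 \<le> (cmod (\<zeta> - z))\<^sup>2" using assms by (intro power_mono) auto
  then show ?thesis
    unfolding poisson_kernel_def using assms by (intro frac_le) auto
qed

text \<open>This is the real part of the Herglotz kernel
  \<open>(\<zeta> + z) / (\<zeta> - z)\<close>, written so that the Cauchy kernel appears and its
  mean over the circle can be read off.\<close>

lemma poisson_kernel_eq_Re: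
  assumes "cmod \<zeta> = 1" "\<zeta> \<noteq> z"
  shows "poisson_kernel z \<zeta> = Re (2 * (\<zeta> / (\<zeta> - z)) - 1)"
proof -
  have "2 * (\<zeta> / (\<zeta> - z)) - 1 = (\<zeta> + z) / (\<zeta> - z)"
    using assms by (simp add: field_simps)
  also have "\<dots> = ((\<zeta> + z) * cnj (\<zeta> - z)) / (cmod (\<zeta> - z))\<^sup>2"
    using complex_div_cnj[of "\<zeta> + z" "\<zeta> - z"] by simp
  finally have "Re (2 * (\<zeta> / (\<zeta> - z)) - 1) = Re ((\<zeta> + z) * cnj (\<zeta> - z)) / (cmod (\<zeta> - z))\<^sup>2"
    by (metis Re_divide_of_real)
  also have "Re ((\<zeta> + z) * cnj (\<zeta> - z)) = (cmod \<zeta>)\<^sup>2 - (cmod z)\<^sup>2"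
    unfolding cmod_power2 by (simp add: algebra_simps power2_eq_square)
  finally show ?thesis unfolding poisson_kernel_def using assms by simp
qed

text \<open>Cauchy's formula for the constant 1 shows that \<open>\<zeta> / (\<zeta> - z)\<close>
  has mean 1 on the circle, so the real part above has mean \<open>2 * 1 - 1\<close>. The
  nonnegative integral is the form that suits Tonelli.\<close>

lemma nn_integral_poisson_kernel:
  assumes z: "z \<in> ball 0 1"
  shows "(\<integral>\<^sup>+ \<zeta>. ennreal (poisson_kernel z \<zeta>) \<partial>circle_measure) = 1"
proof -
  have "((\<lambda>w. 1 / (w - z)) has_contour_integral (2 * of_real pi * \<i>)) (circlepath 0 1)"
    using Cauchy_integral_circlepath_simple[of "\<lambda>_. 1" 0 1 z] z by simp
  then have "((\<lambda>t. 1 / (cis t - z) * \<i> * cis t) has_integral (2 * of_real pi * \<i>)) {0..2*pi}"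
    unfolding circlepath_def by (subst (asm) has_contour_integral_part_circlepath_iff) auto
  \<comment> \<open>The factor \<open>- 2 * \<i>\<close> cancels the \<open>\<i>\<close> of the
    parametrisation and leaves twice the Cauchy kernel.\<close>
  from has_integral_mult_right[OF this, of "- 2 * \<i>"]
  have "((\<lambda>t. 2 * (cis t / (cis t - z))) has_integral (4 * of_real pi)) {0..2*pi}"
    by (rule has_integral_eq_rhs[OF has_integral_eq, rotated]) (auto simp: field_simps)
  from has_integral_diff[OF this has_integral_const_real[of 1 0 "2*pi"]]
  have "((\<lambda>t. 2 * (cis t / (cis t - z)) - 1) has_integral (of_real (2 * pi))) {0..2*pi}"
    by (simp add: scaleR_conv_of_real)
  from has_integral_Re[OF this]
  have "((\<lambda>t. Re (2 * (cis t / (cis t - z)) - 1)) has_integral 2 * pi) {0..2*pi}" by simp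
  moreover have "Re (2 * (cis t / (cis t - z)) - 1) = poisson_kernel z (cis t)" for t
    using z by (subst poisson_kernel_eq_Re) auto
  ultimately have "((\<lambda>t. poisson_kernel z (cis t)) has_integral 2 * pi) {0..2*pi}"
    by (simp only:)
  from nn_integral_has_integral_lebesgue[OF _ this] poisson_kernel_nonneg[OF z]
  have "(\<integral>\<^sup>+ t. indicator {0..2*pi} t * poisson_kernel z (cis t) \<partial>lborel) = ennreal (2 * pi)"
    by simp
  then have "(\<integral>\<^sup>+ t. ennreal (poisson_kernel z (cis t)) * indicator {0..2*pi} t \<partial>lborel) = ennreal (2 * pi)"
    by (subst (asm) nn_integral_cong) (auto simp: indicator_def)
  then show ?thesis
    by (subst nn_integral_circle_measure) (auto simp: ennreal_mult[symmetric] simp del: ennreal_1)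
qed

section \<open>Poisson integrals\<close>

text \<open>For fixed \<open>z\<close> the kernel is bounded on the unit circle.
  \<open>circle_measure\<close> is a measure on the whole plane concentrated on the circle, so the
  bound is used almost everywhere.\<close>

lemma integrable_poisson_kernel_mult:
  assumes z: "z \<in> ball 0 1" and f: "integrable circle_measure f"
  shows "integrable circle_measure (\<lambda>\<zeta>. poisson_kernel z \<zeta> * f \<zeta>)"
proof (rule Bochner_Integration.integrable_bound)
  show "integrable circle_measure (\<lambda>\<zeta>. 1 / (1 - cmod z)\<^sup>2 * f \<zeta>)" using f by simp
  show "AE \<zeta> in circle_measure. norm (poisson_kernel z \<zeta> * f \<zeta>) \<le> norm (1 / (1 - cmod z)\<^sup>2 * f \<zeta>)"
    using AE_circle_norm
  proof eventually_elim
    case (elim \<zeta>)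
    have "\<bar>poisson_kernel z \<zeta>\<bar> \<le> \<bar>1 / (1 - cmod z)\<^sup>2\<bar>"
      using poisson_kernel_le[of z "cmod z" \<zeta>] poisson_kernel_nonneg[OF z, of \<zeta>] z elim by simp
    then show ?case unfolding real_norm_def abs_mult by (rule mult_right_mono) simp
  qed
qed (use f in measurable)

lemma poisson_integral_mono:
  assumes "z \<in> ball 0 1" "integrable circle_measure f" "integrable circle_measure g" "\<And>\<zeta>. f \<zeta> \<le> g \<zeta>"
  shows "poisson_integral f z \<le> poisson_integral g z"
  unfolding poisson_integral_def using assms poisson_kernel_nonneg[OF assms(1)]
  by (intro integral_mono integrable_poisson_kernel_mult mult_left_mono) auto

lemma poisson_integral_nonneg:
  assumes "z \<in> ball 0 1" "\<And>\<zeta>. 0 \<le> f \<zeta>"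
  shows "0 \<le> poisson_integral f z"
  unfolding poisson_integral_def using assms poisson_kernel_nonneg[OF assms(1)]
  by (intro integral_nonneg_AE) auto

lemma poisson_integral_le:
  assumes z: "z \<in> ball 0 1" and f: "integrable circle_measure f" "\<And>\<zeta>. 0 \<le> f \<zeta>"
  shows "poisson_integral f z \<le> (\<integral>\<zeta>. f \<zeta> \<partial>circle_measure) / (1 - cmod z)\<^sup>2"
proof -
  have "poisson_integral f z \<le> (\<integral>\<zeta>. 1 / (1 - cmod z)\<^sup>2 * f \<zeta> \<partial>circle_measure)"
    unfolding poisson_integral_def
  proof (rule integral_mono_AE)
    show "AE \<zeta> in circle_measure. poisson_kernel z \<zeta> * f \<zeta> \<le> 1 / (1 - cmod z)\<^sup>2 * f \<zeta>"
      using AE_circle_norm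
      by eventually_elim (use z f in \<open>intro mult_right_mono poisson_kernel_le; simp\<close>)
  qed (use z f in \<open>auto intro: integrable_poisson_kernel_mult\<close>)
  then show ?thesis by simp
qed

lemma poisson_integral_add:
  assumes "z \<in> ball 0 1" "integrable circle_measure f" "integrable circle_measure g"
  shows "poisson_integral (\<lambda>\<zeta>. f \<zeta> + g \<zeta>) z = poisson_integral f z + poisson_integral g z"
  unfolding poisson_integral_def distrib_left
  using assms by (intro Bochner_Integration.integral_add integrable_poisson_kernel_mult)

lemma poisson_integral_cmult: "poisson_integral (\<lambda>\<zeta>. c * f \<zeta>) z = c * poisson_integral f z"
  by (simp add: poisson_integral_def mult.left_commute)

text \<open>Dominated convergence: once the points stay in a disc of radius
  \<open>\<rho> < 1\<close>, all kernels share one bound on the circle. Dropping the first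
  \<open>N\<close> terms makes it hold for every index.\<close>

lemma tendsto_poisson_integral:
  assumes z: "z \<in> ball 0 1" and f: "integrable circle_measure f" and s: "s \<longlonglongrightarrow> z"
  shows "(\<lambda>k. poisson_integral f (s k)) \<longlonglongrightarrow> poisson_integral f z"
proof -
  define \<rho> where "\<rho> = (1 + cmod z) / 2"
  have \<rho>: "cmod z < \<rho>" "\<rho> < 1" using z by (auto simp: \<rho>_def)
  have "(\<lambda>k. cmod (s k)) \<longlonglongrightarrow> cmod z" using s by (intro tendsto_norm)
  then have "eventually (\<lambda>k. cmod (s k) < \<rho>) sequentially" using \<rho>(1) by (rule order_tendstoD)
  then obtain N where N: "\<And>k. N \<le> k \<Longrightarrow> cmod (s k) < \<rho>" by (auto simp: eventually_sequentially)
  have sN: "(\<lambda>k. s (k + N)) \<longlonglongrightarrow> z" using s by (rule LIMSEQ_ignore_initial_segment)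
  have "(\<lambda>k. poisson_integral f (s (k + N))) \<longlonglongrightarrow> poisson_integral f z"
    unfolding poisson_integral_def
  proof (rule integral_dominated_convergence)
    show "integrable circle_measure (\<lambda>\<zeta>. 1 / (1 - \<rho>)\<^sup>2 * \<bar>f \<zeta>\<bar>)" using f by simp
    show "AE \<zeta> in circle_measure. (\<lambda>k. poisson_kernel (s (k + N)) \<zeta> * f \<zeta>) \<longlonglongrightarrow> poisson_kernel z \<zeta> * f \<zeta>"
      using AE_circle_norm
    proof eventually_elim
      case (elim \<zeta>)
      have "(cmod (\<zeta> - z))\<^sup>2 \<noteq> 0" using elim z by auto
      then show ?case unfolding poisson_kernel_def by (intro tendsto_intros sN)
    qed
    show "AE \<zeta> in circle_measure. norm (poisson_kernel (s (k + N)) \<zeta> * f \<zeta>) \<le> 1 / (1 - \<rho>)\<^sup>2 * \<bar>f \<zeta>\<bar>" for k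
      using AE_circle_norm
    proof eventually_elim
      case (elim \<zeta>)
      have k: "cmod (s (k + N)) < \<rho>" by (rule N) simp
      have "\<bar>poisson_kernel (s (k + N)) \<zeta>\<bar> \<le> 1 / (1 - \<rho>)\<^sup>2"
        using poisson_kernel_le[of "s (k + N)" \<rho> \<zeta>] poisson_kernel_nonneg[of "s (k + N)" \<zeta>] k \<rho> elim by simp
      then show ?case unfolding real_norm_def abs_mult by (rule mult_right_mono) simp
    qed
  qed (use f in measurable)
  then show ?thesis by (rule LIMSEQ_offset)
qed

section \<open>Growth and regularity of the modified function\<close>

locale orlicz_pair =
  fixes \<phi> \<psi> :: "real \<Rightarrow> real"
  assumes strongly_convex: "strongly_convex \<phi>" and modification: "modification_of \<psi> \<phi>"
begin

lemma phi_nonneg: "0 \<le> \<phi> t" and phi_mono: "mono \<phi>"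
  using strongly_convex by (auto simp: strongly_convex_def)

lemma phi_measurable [measurable]: "\<phi> \<in> borel_measurable borel"
  using phi_mono by (rule borel_measurable_mono)

lemma psi_nonneg: "0 \<le> t \<Longrightarrow> 0 \<le> \<psi> t"
  and psi_convex: "convex_on {0..} \<psi>" and psi_zero: "\<psi> 0 = 0"
  using modification by (auto simp: modification_of_def)

lemma psi_convexD:
  assumes "0 \<le> s" "0 \<le> t" "0 \<le> a" "a \<le> 1"
  shows "\<psi> ((1 - a) * s + a * t) \<le> (1 - a) * \<psi> s + a * \<psi> t"
  using convex_onD[OF psi_convex, of a s t] assms by simp

lemma psi_scale: "0 \<le> a \<Longrightarrow> a \<le> 1 \<Longrightarrow> 0 \<le> t \<Longrightarrow> \<psi> (a * t) \<le> a * \<psi> t"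
  using psi_convexD[of 0 t a] by (simp add: psi_zero)

text \<open>Monotonicity is not built into \<open>modification_of\<close>; it comes from the chord
  to the origin, where \<open>\<psi>\<close> vanishes, and from
  \<open>\<psi> t \<ge> 0\<close>.\<close>

lemma psi_mono:
  assumes "0 \<le> s" "s \<le> t"
  shows "\<psi> s \<le> \<psi> t"
proof (cases "t = 0")
  case False
  then have t: "0 < t" using assms by simp
  have "\<psi> (s / t * t) \<le> s / t * \<psi> t" using assms t by (intro psi_scale) auto
  also have "\<dots> \<le> 1 * \<psi> t" using assms t by (intro mult_right_mono psi_nonneg) auto
  finally show ?thesis using t by simp
qed (use assms in auto)

text \<open>The even extension is convex on the whole line, so continuity of convex functions on
  open sets also covers the endpoint 0.\<close>

lemma psi_abs_continuous: "continuous_on UNIV (\<lambda>t. \<psi> \<bar>t\<bar>)"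
proof (rule convex_on_continuous)
  show "convex_on UNIV (\<lambda>t. \<psi> \<bar>t\<bar>)"
  proof (rule convex_onI)
    fix a x y :: real assume a: "0 < a" "a < 1"
    have "\<bar>(1 - a) * x + a * y\<bar> \<le> (1 - a) * \<bar>x\<bar> + a * \<bar>y\<bar>"
      using a abs_triangle_ineq[of "(1 - a) * x" "a * y"] by (simp add: abs_mult)
    then have "\<psi> \<bar>(1 - a) * x + a * y\<bar> \<le> \<psi> ((1 - a) * \<bar>x\<bar> + a * \<bar>y\<bar>)" by (intro psi_mono) auto
    also have "\<dots> \<le> (1 - a) * \<psi> \<bar>x\<bar> + a * \<psi> \<bar>y\<bar>" using a by (intro psi_convexD) auto
    finally show "\<psi> \<bar>(1 - a) *\<^sub>R x + a *\<^sub>R y\<bar> \<le> (1 - a) * \<psi> \<bar>x\<bar> + a * \<psi> \<bar>y\<bar>" by simp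
  qed simp
qed simp

text \<open>Nothing is known of \<open>\<psi>\<close> at negative arguments; for nonnegative
  \<open>f\<close> it can be replaced by its continuous even extension.\<close>

lemma psi_measurable:
  assumes [measurable]: "f \<in> borel_measurable M" and f: "\<And>x. 0 \<le> f x"
  shows "(\<lambda>x. \<psi> (f x)) \<in> borel_measurable M"
proof -
  have "(\<lambda>t. \<psi> \<bar>t\<bar>) \<in> borel_measurable borel"
    using psi_abs_continuous by (rule borel_measurable_continuous_onI)
  from measurable_compose[OF assms(1) this] show ?thesis using f by simp
qed

text \<open>Both functions are nondecreasing on the half-line and agree beyond some
  \<open>t0\<close>, so their difference is bounded. On a finite measure space they therefore make
  the same compositions integrable.\<close>

lemma phi_psi_close: "\<exists>B\<ge>0. \<forall>t\<ge>0. \<phi> t \<le> \<psi> t + B \<and> \<psi> t \<le> \<phi> t + B"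
proof -
  obtain t0 where t0: "0 \<le> t0" "\<And>t. t0 \<le> t \<Longrightarrow> \<psi> t = \<phi> t"
    using modification by (auto simp: modification_of_def)
  have "\<phi> t \<le> \<psi> t + (\<phi> t0 + \<psi> t0) \<and> \<psi> t \<le> \<phi> t + (\<phi> t0 + \<psi> t0)" if "0 \<le> t" for t
  proof (cases "t0 \<le> t")
    case True
    then show ?thesis using t0 phi_nonneg psi_nonneg by simp
  next
    case False
    then have "\<phi> t \<le> \<phi> t0" "\<psi> t \<le> \<psi> t0"
      using monoD[OF phi_mono, of t t0] psi_mono[OF that, of t0] by auto
    then show ?thesis using phi_nonneg[of t] phi_nonneg[of t0] psi_nonneg[of t0] psi_nonneg[OF that] t0 by linarith
  qed
  then show ?thesis using phi_nonneg psi_nonneg t0 by (intro exI[of _ "\<phi> t0 + \<psi> t0"]) auto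
qed

text \<open>The part of \<open>t\<close> above the level \<open>T\<close> costs at most
  \<open>e * \<psi> t\<close>. This is the de la Vallee-Poussin criterion for uniform integrability
  in a form ready to be integrated.\<close>

lemma psi_superlinear:
  assumes e: "0 < e"
  shows "\<exists>T\<ge>0. \<forall>t\<ge>0. t \<le> min t T + e * \<psi> t"
proof -
  obtain t0 where t0: "0 \<le> t0" "\<And>t. t0 \<le> t \<Longrightarrow> \<psi> t = \<phi> t"
    using modification by (auto simp: modification_of_def)
  have "filterlim (\<lambda>t. \<phi> t / t) at_top at_top" using strongly_convex by (simp add: strongly_convex_def)
  then have "eventually (\<lambda>t. 1 / e \<le> \<phi> t / t) at_top" by (simp add: filterlim_at_top)
  then obtain t1 where t1: "\<And>t. t1 \<le> t \<Longrightarrow> 1 / e \<le> \<phi> t / t" by (auto simp: eventually_at_top_linorder)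
  define T where "T = max 1 (max t0 t1)"
  have "t \<le> min t T + e * \<psi> t" if t: "0 \<le> t" for t
  proof (cases "T \<le> t")
    case True
    then have "0 < t" "1 / e \<le> \<psi> t / t" using t0 t1 by (auto simp: T_def)
    then have "t \<le> e * \<psi> t" using e by (simp add: field_simps)
    then show ?thesis using True by (simp add: T_def)
  qed (use e psi_nonneg[OF t] in auto)
  then show ?thesis by (intro exI[of _ T]) (auto simp: T_def)
qed

section \<open>The modular ball and its limits\<close>

text \<open>A convex substitute for the positive part of the unit ball of the Orlicz norm. The bound
  is 2 because norm at most 1 yields an admissible \<open>t < 2\<close> in the infimum, and half of
  the absolute value then lies here.\<close>

definition modular_ball :: "(complex \<Rightarrow> real) set" where
  "modular_ball = {v \<in> borel_measurable borel. (\<forall>\<zeta>. 0 \<le> v \<zeta>) \<and>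
     (\<integral>\<^sup>+ \<zeta>. ennreal (\<psi> (v \<zeta>)) \<partial>circle_measure) \<le> 2}"

text \<open>Superlinearity with \<open>e = 1\<close> gives \<open>f \<le> T + \<psi> f\<close>, and
  the measure is finite.\<close>

lemma integrable_if_modular_finite:
  assumes [measurable]: "f \<in> borel_measurable borel" and f: "\<And>\<zeta>. 0 \<le> f \<zeta>"
    and fin: "(\<integral>\<^sup>+ \<zeta>. ennreal (\<psi> (f \<zeta>)) \<partial>circle_measure) < \<infinity>"
  shows "integrable circle_measure (\<lambda>\<zeta>. \<psi> (f \<zeta>))" "integrable circle_measure f"
proof -
  note [measurable] = psi_measurable[OF _ f]
  show int: "integrable circle_measure (\<lambda>\<zeta>. \<psi> (f \<zeta>))"
    using fin psi_nonneg[OF f] by (intro integrableI_nonneg) auto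
  obtain T where T: "0 \<le> T" "\<And>t. 0 \<le> t \<Longrightarrow> t \<le> min t T + 1 * \<psi> t" using psi_superlinear[of 1] by auto
  show "integrable circle_measure f"
  proof (rule integrable_nonneg_le)
    show "integrable circle_measure (\<lambda>\<zeta>. T + \<psi> (f \<zeta>))" using int by simp
    show "f \<zeta> \<le> T + \<psi> (f \<zeta>)" for \<zeta> using T(2)[OF f[of \<zeta>]] by simp
  qed (auto simp: f)
qed

lemma modular_ballD:
  assumes "v \<in> modular_ball"
  shows "v \<in> borel_measurable borel" "0 \<le> v \<zeta>" "integrable circle_measure v"
    "integrable circle_measure (\<lambda>\<zeta>. \<psi> (v \<zeta>))" "(\<integral>\<zeta>. \<psi> (v \<zeta>) \<partial>circle_measure) \<le> 2"
    "(\<integral>\<^sup>+ \<zeta>. ennreal (\<psi> (v \<zeta>)) \<partial>circle_measure) \<le> 2"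
proof -
  show v: "v \<in> borel_measurable borel" "0 \<le> v \<zeta>"
    and le: "(\<integral>\<^sup>+ \<zeta>. ennreal (\<psi> (v \<zeta>)) \<partial>circle_measure) \<le> 2" for \<zeta>
    using assms by (auto simp: modular_ball_def)
  have fin: "(\<integral>\<^sup>+ \<zeta>. ennreal (\<psi> (v \<zeta>)) \<partial>circle_measure) < \<infinity>" using le by (rule order.strict_trans1) simp
  show "integrable circle_measure v" and int: "integrable circle_measure (\<lambda>\<zeta>. \<psi> (v \<zeta>))"
    using integrable_if_modular_finite[OF v fin] by auto
  have "ennreal (\<integral>\<zeta>. \<psi> (v \<zeta>) \<partial>circle_measure) \<le> ennreal 2"
    using le nn_integral_eq_integral[OF int] psi_nonneg[OF v(2)] by simp
  then show "(\<integral>\<zeta>. \<psi> (v \<zeta>) \<partial>circle_measure) \<le> 2" by (subst (asm) ennreal_le_iff) auto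
qed

lemma modular_ballI:
  assumes v: "v \<in> borel_measurable borel" "\<And>\<zeta>. 0 \<le> v \<zeta>"
    and int: "integrable circle_measure (\<lambda>\<zeta>. \<psi> (v \<zeta>))" and le: "(\<integral>\<zeta>. \<psi> (v \<zeta>) \<partial>circle_measure) \<le> 2"
  shows "v \<in> modular_ball"
  unfolding modular_ball_def using v nn_integral_eq_integral[OF int] psi_nonneg[OF v(2)] le
  by (auto simp: ennreal_le_iff2 simp flip: ennreal_numeral)

lemma modular_ball_convex:
  assumes v: "v \<in> modular_ball" and w: "w \<in> modular_ball" and a: "0 \<le> a" "a \<le> 1"
  shows "(\<lambda>\<zeta>. (1 - a) * v \<zeta> + a * w \<zeta>) \<in> modular_ball"
proof (rule modular_ballI)
  note [measurable] = modular_ballD(1)[OF v] modular_ballD(1)[OF w]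
  show "(\<lambda>\<zeta>. (1 - a) * v \<zeta> + a * w \<zeta>) \<in> borel_measurable borel" by measurable
  show nn: "0 \<le> (1 - a) * v \<zeta> + a * w \<zeta>" for \<zeta>
    using modular_ballD(2)[OF v] modular_ballD(2)[OF w] a by simp
  note [measurable] = psi_measurable[OF _ nn]
  have le: "\<psi> ((1 - a) * v \<zeta> + a * w \<zeta>) \<le> (1 - a) * \<psi> (v \<zeta>) + a * \<psi> (w \<zeta>)" for \<zeta>
    using modular_ballD(2)[OF v] modular_ballD(2)[OF w] a by (rule psi_convexD)
  have int: "integrable circle_measure (\<lambda>\<zeta>. (1 - a) * \<psi> (v \<zeta>) + a * \<psi> (w \<zeta>))"
    using modular_ballD(4)[OF v] modular_ballD(4)[OF w] by simp
  show int2: "integrable circle_measure (\<lambda>\<zeta>. \<psi> ((1 - a) * v \<zeta> + a * w \<zeta>))"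
    using psi_nonneg[OF nn] le by (intro integrable_nonneg_le[OF int]) auto
  have "(\<integral>\<zeta>. \<psi> ((1 - a) * v \<zeta> + a * w \<zeta>) \<partial>circle_measure)
      \<le> (\<integral>\<zeta>. (1 - a) * \<psi> (v \<zeta>) + a * \<psi> (w \<zeta>) \<partial>circle_measure)"
    using int2 int le by (rule integral_mono)
  also have "\<dots> = (1 - a) * (\<integral>\<zeta>. \<psi> (v \<zeta>) \<partial>circle_measure) + a * (\<integral>\<zeta>. \<psi> (w \<zeta>) \<partial>circle_measure)"
    using modular_ballD(4)[OF v] modular_ballD(4)[OF w] by simp
  also have "\<dots> \<le> (1 - a) * 2 + a * 2"
    using modular_ballD(5)[OF v] modular_ballD(5)[OF w] a by (intro add_mono mult_left_mono) auto
  finally show "(\<integral>\<zeta>. \<psi> ((1 - a) * v \<zeta> + a * w \<zeta>) \<partial>circle_measure) \<le> 2" by simp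
qed

lemma modular_ball_zero: "(\<lambda>_. 0) \<in> modular_ball"
  by (simp add: modular_ball_def psi_zero)

text \<open>Supplies the bound on coordinates that the finite-dimensional separation asks
  for.\<close>

lemma modular_ball_integral_bounded: "\<exists>B. \<forall>v\<in>modular_ball. (\<integral>\<zeta>. v \<zeta> \<partial>circle_measure) \<le> B"
proof -
  obtain T where T: "0 \<le> T" "\<And>t. 0 \<le> t \<Longrightarrow> t \<le> min t T + 1 * \<psi> t" using psi_superlinear[of 1] by auto
  have "(\<integral>\<zeta>. v \<zeta> \<partial>circle_measure) \<le> T * measure circle_measure UNIV + 2" if v: "v \<in> modular_ball" for v
  proof -
    have "v \<zeta> \<le> T + \<psi> (v \<zeta>)" for \<zeta> using T(2)[OF modular_ballD(2)[OF v, of \<zeta>]] by simp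
    then have "(\<integral>\<zeta>. v \<zeta> \<partial>circle_measure) \<le> (\<integral>\<zeta>. T + \<psi> (v \<zeta>) \<partial>circle_measure)"
      using modular_ballD(3,4)[OF v] by (intro integral_mono) auto
    also have "\<dots> \<le> T * measure circle_measure UNIV + 2"
      using modular_ballD(4,5)[OF v] by simp
    finally show ?thesis .
  qed
  then show ?thesis by blast
qed

text \<open>Superlinearity of \<open>\<psi>\<close> makes the modular ball uniformly integrable, so no mass is lost in the limit.\<close>

lemma poisson_integral_limit_ge:
  assumes vn: "\<And>n. f n \<in> modular_ball" and v: "v \<in> modular_ball"
    and lim: "AE \<zeta> in circle_measure. (\<lambda>n. f n \<zeta>) \<longlonglongrightarrow> v \<zeta>"
    and z: "z \<in> ball 0 1" and s: "s \<longlonglongrightarrow> l" "\<And>n. n \<ge> N \<Longrightarrow> s n \<le> poisson_integral (f n) z"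
  shows "l \<le> poisson_integral v z"
proof (rule field_le_epsilon)
  fix e :: real assume e: "0 < e"
  define c where "c = 1 / (1 - cmod z)\<^sup>2"
  have c: "0 < c" using z by (auto simp: c_def)
  \<comment> \<open>The kernel is at most \<open>c\<close> on the circle and the integral of
    \<open>\<psi> (f n)\<close> at most 2, so with the weight \<open>e / (2 * c)\<close> the part
    above \<open>T\<close> contributes at most \<open>e\<close>.\<close>
  obtain T where T: "0 \<le> T" "\<And>t. 0 \<le> t \<Longrightarrow> t \<le> min t T + e / (2 * c) * \<psi> t"
    using psi_superlinear[of "e / (2 * c)"] e c by auto
  note [measurable] = modular_ballD(1)[OF vn] modular_ballD(1)[OF v]
  have int_min: "integrable circle_measure (\<lambda>\<zeta>. min (g \<zeta>) T)" if "g \<in> modular_ball" for g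
    using modular_ballD(1,2)[OF that] T(1) by (intro circle.integrable_const_bound[where B=T]) auto
  have le: "s n \<le> poisson_integral (\<lambda>\<zeta>. min (f n \<zeta>) T) z + e" if "n \<ge> N" for n
  proof -
    have psi: "integrable circle_measure (\<lambda>\<zeta>. e / (2 * c) * \<psi> (f n \<zeta>))"
      using modular_ballD(4)[OF vn] by simp
    have "poisson_integral (f n) z \<le> poisson_integral (\<lambda>\<zeta>. min (f n \<zeta>) T + e / (2 * c) * \<psi> (f n \<zeta>)) z"
      using modular_ballD(3)[OF vn] int_min[OF vn] psi T(2)[OF modular_ballD(2)[OF vn]]
      by (intro poisson_integral_mono z) auto
    also have "\<dots> = poisson_integral (\<lambda>\<zeta>. min (f n \<zeta>) T) z + e / (2 * c) * poisson_integral (\<lambda>\<zeta>. \<psi> (f n \<zeta>)) z"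
      using poisson_integral_add[OF z int_min[OF vn] psi] by (simp only: poisson_integral_cmult)
    also have "poisson_integral (\<lambda>\<zeta>. \<psi> (f n \<zeta>)) z \<le> c * (\<integral>\<zeta>. \<psi> (f n \<zeta>) \<partial>circle_measure)"
      using poisson_integral_le[OF z modular_ballD(4)[OF vn]] psi_nonneg[OF modular_ballD(2)[OF vn]]
      by (simp add: c_def)
    also have "\<dots> \<le> c * 2" using modular_ballD(5)[OF vn] c by (intro mult_left_mono) auto
    finally show ?thesis using s(2)[OF that] e c by (simp add: mult_left_mono field_simps)
  qed
  \<comment> \<open>After truncation the integrands are dominated by \<open>T\<close> times the
    kernel.\<close>
  have "(\<lambda>n. poisson_integral (\<lambda>\<zeta>. min (f n \<zeta>) T) z) \<longlonglongrightarrow> poisson_integral (\<lambda>\<zeta>. min (v \<zeta>) T) z"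
    unfolding poisson_integral_def
  proof (rule integral_dominated_convergence)
    show "integrable circle_measure (\<lambda>\<zeta>. poisson_kernel z \<zeta> * T)"
      using z by (intro integrable_poisson_kernel_mult) auto
    show "AE \<zeta> in circle_measure. (\<lambda>n. poisson_kernel z \<zeta> * min (f n \<zeta>) T) \<longlonglongrightarrow> poisson_kernel z \<zeta> * min (v \<zeta>) T"
      using lim by eventually_elim (intro tendsto_intros)
    show "AE \<zeta> in circle_measure. norm (poisson_kernel z \<zeta> * min (f n \<zeta>) T) \<le> poisson_kernel z \<zeta> * T" for n
      using poisson_kernel_nonneg[OF z] modular_ballD(2)[OF vn] T(1)
      by (intro AE_I2) (auto simp: abs_mult intro!: mult_left_mono)
  qed measurable
  then have "l \<le> poisson_integral (\<lambda>\<zeta>. min (v \<zeta>) T) z + e"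
    using le by (intro LIMSEQ_le[OF s(1) tendsto_add[OF _ tendsto_const]]) auto
  also have "poisson_integral (\<lambda>\<zeta>. min (v \<zeta>) T) z \<le> poisson_integral v z"
    using int_min[OF v] modular_ballD(3)[OF v] by (intro poisson_integral_mono z) auto
  finally show "l \<le> poisson_integral v z + e" by simp
qed

text \<open>One application of Fatou's lemma serves twice. It makes the lower limit of
  \<open>\<psi> (f n)\<close> finite almost everywhere, which keeps \<open>f n\<close> from tending
  to infinity; and once continuity identifies this lower limit with \<open>\<psi> v\<close>, it puts
  \<open>v\<close> into the ball.\<close>

lemma modular_ball_AE_limit:
  assumes f: "\<And>n. f n \<in> modular_ball"
    and Cau: "AE \<zeta> in circle_measure. Cauchy (\<lambda>n. exp (- f n \<zeta> / 2))"
  shows "\<exists>v\<in>modular_ball. AE \<zeta> in circle_measure. (\<lambda>n. f n \<zeta>) \<longlonglongrightarrow> v \<zeta>"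
proof -
  note [measurable] = modular_ballD(1)[OF f] psi_measurable[OF _ modular_ballD(2)[OF f]]
  \<comment> \<open>\<open>lim\<close> is an unspecified value where the sequence diverges; the
    maximum with 0 makes \<open>v\<close> nonnegative everywhere, as \<open>modular_ball\<close>
    demands.\<close>
  define v where "v \<zeta> = max 0 (lim (\<lambda>n. f n \<zeta>))" for \<zeta>
  have v [measurable]: "v \<in> borel_measurable borel" unfolding v_def by measurable
  have v0: "0 \<le> v \<zeta>" for \<zeta> by (simp add: v_def)
  note [measurable] = psi_measurable[OF _ v0]
  have "(\<integral>\<^sup>+ \<zeta>. liminf (\<lambda>n. ennreal (\<psi> (f n \<zeta>))) \<partial>circle_measure)
      \<le> liminf (\<lambda>n. \<integral>\<^sup>+ \<zeta>. ennreal (\<psi> (f n \<zeta>)) \<partial>circle_measure)"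
    by (rule nn_integral_liminf) measurable
  also have "\<dots> \<le> liminf (\<lambda>n. 2)" using modular_ballD(6)[OF f] by (intro Liminf_mono) auto
  finally have fatou: "(\<integral>\<^sup>+ \<zeta>. liminf (\<lambda>n. ennreal (\<psi> (f n \<zeta>))) \<partial>circle_measure) \<le> 2"
    by (simp add: Liminf_const)
  then have "AE \<zeta> in circle_measure. liminf (\<lambda>n. ennreal (\<psi> (f n \<zeta>))) \<noteq> \<infinity>"
    by (intro nn_integral_PInf_AE) (auto simp: top_unique)
  with Cau have lim: "AE \<zeta> in circle_measure. (\<lambda>n. f n \<zeta>) \<longlonglongrightarrow> v \<zeta>"
  proof eventually_elim
    case (elim \<zeta>)
    from elim(1) obtain g where g: "(\<lambda>n. exp (- f n \<zeta> / 2)) \<longlonglongrightarrow> g"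
      by (auto simp: Cauchy_convergent_iff convergent_def)
    have "0 \<le> g" by (rule LIMSEQ_le_const[OF g]) auto
    \<comment> \<open>A limit 0 would mean that \<open>f n \<zeta>\<close> tends to infinity, and
      since \<open>\<psi> t \<ge> t - T\<close>, so would
      \<open>\<psi> (f n \<zeta>)\<close>.\<close>
    have "g \<noteq> 0"
    proof
      assume "g = 0"
      have "liminf (\<lambda>n. ennreal (\<psi> (f n \<zeta>))) \<ge> ennreal y" for y :: real
      proof -
        obtain T where T: "0 \<le> T" "\<And>t. 0 \<le> t \<Longrightarrow> t \<le> min t T + 1 * \<psi> t" using psi_superlinear[of 1] by auto
        have "eventually (\<lambda>n. exp (- f n \<zeta> / 2) < exp (- (T + y) / 2)) sequentially"
          using g \<open>g = 0\<close> by (intro order_tendstoD(2)[OF g]) auto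
        then have "eventually (\<lambda>n. ennreal y \<le> ennreal (\<psi> (f n \<zeta>))) sequentially"
        proof eventually_elim
          case (elim n)
          then have "T + y < f n \<zeta>" by (simp add: field_simps)
          with T(2)[OF modular_ballD(2)[OF f, of n \<zeta>]] show ?case by (intro ennreal_leI) auto
        qed
        then show ?thesis by (intro Liminf_bounded)
      qed
      note ge = this
      obtain y0 where y0: "0 \<le> y0" "liminf (\<lambda>n. ennreal (\<psi> (f n \<zeta>))) = ennreal y0"
        using elim(2) by (cases "liminf (\<lambda>n. ennreal (\<psi> (f n \<zeta>)))") auto
      with ge[of "y0 + 1"] show False by simp
    qed
    with \<open>0 \<le> g\<close> have "0 < g" by simp
    then have "(\<lambda>n. - 2 * ln (exp (- f n \<zeta> / 2))) \<longlonglongrightarrow> - 2 * ln g"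
      by (intro tendsto_intros g) auto
    then have lim: "(\<lambda>n. f n \<zeta>) \<longlonglongrightarrow> - 2 * ln g" by simp
    moreover have "0 \<le> - 2 * ln g"
      by (rule LIMSEQ_le_const[OF lim]) (use modular_ballD(2)[OF f] in auto)
    ultimately show ?case by (simp add: v_def limI)
  qed
  have "(\<integral>\<^sup>+ \<zeta>. ennreal (\<psi> (v \<zeta>)) \<partial>circle_measure) = (\<integral>\<^sup>+ \<zeta>. liminf (\<lambda>n. ennreal (\<psi> (f n \<zeta>))) \<partial>circle_measure)"
  proof (rule nn_integral_cong_AE)
    show "AE \<zeta> in circle_measure. ennreal (\<psi> (v \<zeta>)) = liminf (\<lambda>n. ennreal (\<psi> (f n \<zeta>)))"
      using lim
    proof eventually_elim
      case (elim \<zeta>)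
      have "isCont (\<lambda>t. \<psi> \<bar>t\<bar>) (v \<zeta>)"
        using psi_abs_continuous by (simp add: continuous_on_eq_continuous_at)
      from isCont_tendsto_compose[OF this elim] have "(\<lambda>n. \<psi> (f n \<zeta>)) \<longlonglongrightarrow> \<psi> (v \<zeta>)"
        using modular_ballD(2)[OF f] v0 by simp
      then have "(\<lambda>n. ennreal (\<psi> (f n \<zeta>))) \<longlonglongrightarrow> ennreal (\<psi> (v \<zeta>))" by (rule tendsto_ennrealI)
      then show ?case by (simp add: lim_imp_Liminf)
    qed
  qed
  with fatou v v0 have "v \<in> modular_ball" by (simp add: modular_ball_def)
  with lim show ?thesis by blast
qed

section \<open>The Orlicz space and its norm\<close>

lemma orlicz_spaceD:
  assumes "w \<in> orlicz_space \<phi>"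
  shows "w \<in> borel_measurable borel" "(\<integral>\<^sup>+ \<zeta>. ennreal (\<psi> \<bar>w \<zeta>\<bar>) \<partial>circle_measure) < \<infinity>"
    "integrable circle_measure w"
proof -
  show [measurable]: "w \<in> borel_measurable borel"
    using assms by (simp add: orlicz_space_def cong: measurable_cong_sets)
  have int: "integrable circle_measure (\<lambda>\<zeta>. \<phi> \<bar>w \<zeta>\<bar>)"
    using assms by (simp add: orlicz_space_def)
  note [measurable] = psi_measurable[of "\<lambda>\<zeta>. \<bar>w \<zeta>\<bar>"]
  obtain B where B: "0 \<le> B" "\<And>t. 0 \<le> t \<Longrightarrow> \<psi> t \<le> \<phi> t + B" using phi_psi_close by auto
  have "integrable circle_measure (\<lambda>\<zeta>. \<psi> \<bar>w \<zeta>\<bar>)"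
  proof (rule integrable_nonneg_le)
    show "integrable circle_measure (\<lambda>\<zeta>. \<phi> \<bar>w \<zeta>\<bar> + B)" using int by simp
  qed (auto simp: psi_nonneg B)
  from nn_integral_eq_integral[OF this]
  show fin: "(\<integral>\<^sup>+ \<zeta>. ennreal (\<psi> \<bar>w \<zeta>\<bar>) \<partial>circle_measure) < \<infinity>" by (simp add: psi_nonneg)
  have "integrable circle_measure (\<lambda>\<zeta>. \<bar>w \<zeta>\<bar>)"
    using fin by (intro integrable_if_modular_finite) auto
  then show "integrable circle_measure w"
    by (subst (asm) integrable_abs_iff) auto
qed

lemma orlicz_space_scale:
  assumes w: "w \<in> orlicz_space \<phi>" and t: "1 \<le> t"
  shows "(\<lambda>\<zeta>. \<bar>w \<zeta>\<bar> / t) \<in> orlicz_space \<phi>"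
proof -
  note [measurable] = orlicz_spaceD(1)[OF w]
  have int: "integrable circle_measure (\<lambda>\<zeta>. \<phi> \<bar>w \<zeta>\<bar>)" using w by (simp add: orlicz_space_def)
  have "\<bar>w \<zeta>\<bar> / t \<le> \<bar>w \<zeta>\<bar> / 1" for \<zeta> using t by (intro divide_left_mono) auto
  then have "\<phi> (\<bar>w \<zeta>\<bar> / t) \<le> \<phi> \<bar>w \<zeta>\<bar>" for \<zeta> using monoD[OF phi_mono] by simp
  then have "integrable circle_measure (\<lambda>\<zeta>. \<phi> (\<bar>w \<zeta>\<bar> / t))"
    using phi_nonneg by (intro integrable_nonneg_le[OF int]) auto
  then show ?thesis using t by (simp add: orlicz_space_def)
qed

text \<open>By convexity and \<open>\<psi> 0 = 0\<close>, dividing the function by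
  \<open>t \<ge> 1\<close> divides its modular by at least \<open>t\<close>. This brings every
  element into the unit ball and shows that the infimum in \<open>orlicz_norm\<close> is over a
  nonempty set.\<close>

lemma orlicz_space_modular_le_one:
  assumes w: "w \<in> orlicz_space \<phi>"
  obtains t where "1 \<le> t" "(\<integral>\<^sup>+ \<zeta>. ennreal (\<psi> (\<bar>w \<zeta>\<bar> / t)) \<partial>circle_measure) \<le> 1"
proof -
  note [measurable] = orlicz_spaceD(1)[OF w] psi_measurable[of "\<lambda>\<zeta>. \<bar>w \<zeta>\<bar>"]
  obtain q where q: "0 \<le> q" "(\<integral>\<^sup>+ \<zeta>. ennreal (\<psi> \<bar>w \<zeta>\<bar>) \<partial>circle_measure) = ennreal q"
    using orlicz_spaceD(2)[OF w]
    by (cases "(\<integral>\<^sup>+ \<zeta>. ennreal (\<psi> \<bar>w \<zeta>\<bar>) \<partial>circle_measure)") auto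
  define t where "t = max 1 q"
  have t: "1 \<le> t" "q \<le> t" by (auto simp: t_def)
  have "\<psi> (\<bar>w \<zeta>\<bar> / t) \<le> 1 / t * \<psi> \<bar>w \<zeta>\<bar>" for \<zeta>
    using psi_scale[of "1 / t" "\<bar>w \<zeta>\<bar>"] t by simp
  then have "(\<integral>\<^sup>+ \<zeta>. ennreal (\<psi> (\<bar>w \<zeta>\<bar> / t)) \<partial>circle_measure)
      \<le> (\<integral>\<^sup>+ \<zeta>. ennreal (1 / t) * ennreal (\<psi> \<bar>w \<zeta>\<bar>) \<partial>circle_measure)"
    using t by (intro nn_integral_mono) (simp add: psi_nonneg ennreal_leI flip: ennreal_mult)
  also have "\<dots> = ennreal (1 / t) * ennreal q" by (subst nn_integral_cmult) (auto simp: q)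
  also have "\<dots> = ennreal (q / t)" using t q by (simp flip: ennreal_mult)
  also have "\<dots> \<le> 1" using t by (simp add: ennreal_le_1)
  finally show thesis using t(1) that by blast
qed

lemma orlicz_norm_le_oneI:
  assumes "(\<integral>\<^sup>+ \<zeta>. ennreal (\<psi> \<bar>w \<zeta>\<bar>) \<partial>circle_measure) \<le> 1"
  shows "orlicz_norm \<psi> w \<le> 1"
  unfolding orlicz_norm_def using assms by (intro cInf_lower bdd_belowI[of _ 0]) auto

text \<open>Whether or not the infimum is attained, some admissible \<open>s\<close> lies below 2,
  and monotonicity of \<open>\<psi>\<close> replaces \<open>s\<close> by 2.\<close>

lemma orlicz_norm_le_oneD:
  assumes w: "w \<in> orlicz_space \<phi>" and le: "orlicz_norm \<psi> w \<le> 1"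
  shows "(\<lambda>\<zeta>. \<bar>w \<zeta>\<bar> / 2) \<in> modular_ball"
proof -
  let ?A = "{t. 0 < t \<and> (\<integral>\<^sup>+ \<zeta>. ennreal (\<psi> (\<bar>w \<zeta>\<bar> / t)) \<partial>circle_measure) \<le> ennreal t}"
  note [measurable] = orlicz_spaceD(1)[OF w]
  obtain t where "1 \<le> t" "(\<integral>\<^sup>+ \<zeta>. ennreal (\<psi> (\<bar>w \<zeta>\<bar> / t)) \<partial>circle_measure) \<le> 1"
    using orlicz_space_modular_le_one[OF w] .
  then have "t \<in> ?A" by (auto intro: order_trans)
  then have "?A \<noteq> {}" by blast
  moreover have "Inf ?A < 2" using le by (simp add: orlicz_norm_def)
  ultimately obtain s where s: "0 < s" "s < 2"
    "(\<integral>\<^sup>+ \<zeta>. ennreal (\<psi> (\<bar>w \<zeta>\<bar> / s)) \<partial>circle_measure) \<le> ennreal s"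
    using cInf_lessD[of ?A 2] by auto
  have "(\<integral>\<^sup>+ \<zeta>. ennreal (\<psi> (\<bar>w \<zeta>\<bar> / 2)) \<partial>circle_measure) \<le> (\<integral>\<^sup>+ \<zeta>. ennreal (\<psi> (\<bar>w \<zeta>\<bar> / s)) \<partial>circle_measure)"
    using s by (intro nn_integral_mono ennreal_leI psi_mono divide_left_mono) auto
  also have "\<dots> \<le> ennreal 2" using s(2) by (intro order_trans[OF s(3)] ennreal_leI) simp
  finally show ?thesis by (simp add: modular_ball_def)
qed

section \<open>From a majorant to the bound on measures\<close>

text \<open>By Tonelli, integrating the Poisson integral of the absolute value of \<open>w\<close>
  against \<open>\<mu>\<close> is pairing that absolute value with the balayage. Divided by
  \<open>t\<close> it lies in the unit ball, so the pairing is at most \<open>t\<close>, which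
  depends on \<open>w\<close> alone.\<close>

lemma balayage_bound:
  assumes w: "w \<in> orlicz_space \<phi>"
  obtains C where "0 \<le> C" "\<And>\<mu>. \<mu> \<in> B_phi_star \<phi> \<psi> \<Longrightarrow>
    (\<integral>\<^sup>+ z. ennreal (poisson_integral w z) * indicator (ball 0 1) z \<partial>\<mu>) \<le> ennreal C"
proof -
  note [measurable] = orlicz_spaceD(1)[OF w]
  obtain t where t: "1 \<le> t" "(\<integral>\<^sup>+ \<zeta>. ennreal (\<psi> (\<bar>w \<zeta>\<bar> / t)) \<partial>circle_measure) \<le> 1"
    using orlicz_space_modular_le_one[OF w] .
  let ?y = "\<lambda>\<zeta>. \<bar>w \<zeta>\<bar> / t"
  have y: "?y \<in> orlicz_space \<phi>" "orlicz_norm \<psi> ?y \<le> 1"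
    using t by (auto intro!: orlicz_space_scale w orlicz_norm_le_oneI)
  have "(\<integral>\<^sup>+ z. ennreal (poisson_integral w z) * indicator (ball 0 1) z \<partial>\<mu>) \<le> ennreal t"
    if mu: "\<mu> \<in> B_phi_star \<phi> \<psi>" for \<mu>
  proof -
    from mu have sets_mu [measurable_cong]: "sets \<mu> = sets borel" and fin: "finite_measure \<mu>"
      and null: "emeasure \<mu> (UNIV - ball 0 1) = 0" and dual: "dual_norm_le_one \<phi> \<psi> (balayage \<mu>)"
      by (auto simp: B_phi_star_def disc_measures_def)
    interpret mu: finite_measure \<mu> by fact
    interpret pair_sigma_finite \<mu> circle_measure ..
    have AE_ball: "AE z in \<mu>. z \<in> ball 0 1"
      using null by (intro AE_I[of _ _ "UNIV - ball 0 1"]) (auto simp: sets_mu)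
    \<comment> \<open>The balayage with values in \<open>[0, \<infinity>]\<close>. The Bochner
      integral in \<open>balayage\<close> defaults to 0 where \<open>G\<close> is infinite, so
      Tonelli is applied to \<open>G\<close>; its total integral is the mass of \<open>\<mu>\<close>
      in the disc, hence the two agree almost everywhere.\<close>
    define G where "G \<zeta> = (\<integral>\<^sup>+ z. ennreal (poisson_kernel z \<zeta>) * indicator (ball 0 1) z \<partial>\<mu>)" for \<zeta>
    have [measurable]: "ball 0 1 \<in> sets (borel :: complex measure)" by simp
    have [measurable]: "G \<in> borel_measurable borel" unfolding G_def by measurable
    have "(\<integral>\<^sup>+ \<zeta>. G \<zeta> \<partial>circle_measure) =
        (\<integral>\<^sup>+ z. \<integral>\<^sup>+ \<zeta>. ennreal (poisson_kernel z \<zeta>) * indicator (ball 0 1) z \<partial>circle_measure \<partial>\<mu>)"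
      unfolding G_def by (rule Fubini') measurable
    also have "\<dots> = (\<integral>\<^sup>+ z. indicator (ball 0 1) z \<partial>\<mu>)"
      by (intro nn_integral_cong) (simp add: nn_integral_multc nn_integral_poisson_kernel split: split_indicator)
    also have "\<dots> < \<infinity>" using mu.emeasure_finite[of "ball 0 1"] by (simp add: sets_mu flip: less_top)
    finally have AE_G: "AE \<zeta> in circle_measure. G \<zeta> \<noteq> \<infinity>" by (intro nn_integral_PInf_AE) auto
    have bal: "balayage \<mu> \<zeta> = enn2real (G \<zeta>)" for \<zeta>
    proof -
      have "balayage \<mu> \<zeta> = enn2real (\<integral>\<^sup>+ z. ennreal (poisson_kernel z \<zeta>) \<partial>\<mu>)"
        unfolding balayage_def using AE_ball by (intro integral_eq_nn_integral) (auto simp: poisson_kernel_nonneg)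
      also have "(\<integral>\<^sup>+ z. ennreal (poisson_kernel z \<zeta>) \<partial>\<mu>) = G \<zeta>"
        unfolding G_def using AE_ball by (intro nn_integral_cong_AE) auto
      finally show ?thesis .
    qed
    have int: "integrable circle_measure (\<lambda>\<zeta>. balayage \<mu> \<zeta> * ?y \<zeta>)"
      and le1: "(\<integral>\<zeta>. balayage \<mu> \<zeta> * ?y \<zeta> \<partial>circle_measure) \<le> 1"
      using bspec[OF conjunct1[OF dual[unfolded dual_norm_le_one_def]] y(1)]
        abs_le_D1[OF mp[OF bspec[OF conjunct2[OF dual[unfolded dual_norm_le_one_def]] y(1)] y(2)]]
      by simp_all
    have "(\<integral>\<^sup>+ z. ennreal (poisson_integral w z) * indicator (ball 0 1) z \<partial>\<mu>)
        \<le> (\<integral>\<^sup>+ z. \<integral>\<^sup>+ \<zeta>. ennreal (poisson_kernel z \<zeta>) * indicator (ball 0 1) z * ennreal \<bar>w \<zeta>\<bar> \<partial>circle_measure \<partial>\<mu>)"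
    proof (rule nn_integral_mono)
      fix z
      show "ennreal (poisson_integral w z) * indicator (ball 0 1) z
        \<le> (\<integral>\<^sup>+ \<zeta>. ennreal (poisson_kernel z \<zeta>) * indicator (ball 0 1) z * ennreal \<bar>w \<zeta>\<bar> \<partial>circle_measure)"
      proof (cases "z \<in> ball 0 1")
        case True
        have w': "integrable circle_measure (\<lambda>\<zeta>. \<bar>w \<zeta>\<bar>)" using orlicz_spaceD(3)[OF w] by simp
        have "poisson_integral w z \<le> poisson_integral (\<lambda>\<zeta>. \<bar>w \<zeta>\<bar>) z"
          using orlicz_spaceD(3)[OF w] by (intro poisson_integral_mono True) auto
        then have "ennreal (poisson_integral w z) \<le> (\<integral>\<^sup>+ \<zeta>. ennreal (poisson_kernel z \<zeta> * \<bar>w \<zeta>\<bar>) \<partial>circle_measure)"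
          using integrable_poisson_kernel_mult[OF True w'] poisson_kernel_nonneg[OF True]
          by (subst nn_integral_eq_integral) (auto simp: poisson_integral_def ennreal_leI)
        then show ?thesis using True poisson_kernel_nonneg[OF True] by (simp add: ennreal_mult)
      qed simp
    qed
    also have "\<dots> = (\<integral>\<^sup>+ \<zeta>. \<integral>\<^sup>+ z. ennreal (poisson_kernel z \<zeta>) * indicator (ball 0 1) z * ennreal \<bar>w \<zeta>\<bar> \<partial>\<mu> \<partial>circle_measure)"
      by (rule Fubini'[symmetric]) measurable
    also have "\<dots> = (\<integral>\<^sup>+ \<zeta>. G \<zeta> * ennreal \<bar>w \<zeta>\<bar> \<partial>circle_measure)"
      unfolding G_def by (intro nn_integral_cong nn_integral_multc) measurable
    also have "\<dots> = (\<integral>\<^sup>+ \<zeta>. ennreal (t * (balayage \<mu> \<zeta> * ?y \<zeta>)) \<partial>circle_measure)"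
    proof (rule nn_integral_cong_AE, use AE_G in eventually_elim)
      case (elim \<zeta>)
      then have "G \<zeta> = ennreal (balayage \<mu> \<zeta>)" by (simp add: bal less_top)
      then show ?case using t by (simp add: bal ennreal_mult)
    qed
    also have "\<dots> = ennreal (t * (\<integral>\<zeta>. balayage \<mu> \<zeta> * ?y \<zeta> \<partial>circle_measure))"
      using nn_integral_eq_integral[OF integrable_mult_right[OF int, of t]] t
      by (simp only: integral_mult_right_zero) (simp add: bal)
    also have "\<dots> \<le> ennreal (t * 1)"
      using le1 t by (intro ennreal_leI mult_left_mono) auto
    finally show ?thesis by simp
  qed
  with t show thesis by (intro that[of t]) auto
qed

section \<open>From the bound on measures to a majorant\<close>

text \<open>The bound is tested on the measure with mass \<open>l i / (2 * S)\<close> at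
  \<open>z i\<close>. Its balayage is the corresponding combination of Poisson kernels, and
  \<open>le\<close> places it in the dual unit ball.\<close>

lemma finite_combination_bound:
  fixes u :: "complex \<Rightarrow> real" and z :: "nat \<Rightarrow> complex" and l :: "nat \<Rightarrow> real"
  assumes u: "u \<in> borel_measurable (restrict_space borel (ball 0 1))" "\<And>z. z \<in> ball 0 1 \<Longrightarrow> 0 \<le> u z"
    and C: "0 \<le> C" "\<And>\<mu>. \<mu> \<in> B_phi_star \<phi> \<psi> \<Longrightarrow> (\<integral>\<^sup>+ z. ennreal (u z) * indicator (ball 0 1) z \<partial>\<mu>) \<le> ennreal C"
    and z: "\<And>i. z i \<in> ball 0 1" and l: "\<And>i. 0 \<le> l i" and S: "0 < S"
    and le: "\<And>v. v \<in> modular_ball \<Longrightarrow> (\<Sum>i<n. l i * poisson_integral v (z i)) \<le> S"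
  shows "(\<Sum>i<n. l i * u (z i)) \<le> 2 * S * C"
proof -
  \<comment> \<open>\<open>S\<close> normalises the bound \<open>le\<close>; the factor 2
    compensates for the halving in \<open>orlicz_norm_le_oneD\<close>.\<close>
  define c where "c i = l i / (2 * S)" for i
  have c: "0 \<le> c i" for i using l S by (simp add: c_def)
  \<comment> \<open>The masses sit on the indices and are then pushed forward, so the points
    \<open>z i\<close> may coincide.\<close>
  define P where "P = point_measure {..<n} (\<lambda>i. ennreal (c i))"
  define \<mu> where "\<mu> = distr P borel z"
  have zm [measurable]: "z \<in> measurable P borel" by (simp add: P_def)
  have bal: "balayage \<mu> = (\<lambda>\<zeta>. \<Sum>i<n. c i * poisson_kernel (z i) \<zeta>)"
    unfolding balayage_def \<mu>_def
    by (intro ext, subst integral_distr) (auto simp: P_def c lebesgue_integral_point_measure_finite)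
  have "\<mu> \<in> disc_measures"
  proof -
    have "emeasure P (space P) = (\<Sum>i<n. ennreal (c i))"
      using nn_integral_point_measure_finite[of "{..<n}" "\<lambda>i. ennreal (c i)" "\<lambda>_. 1"]
      by (simp add: P_def)
    then have "finite_measure P" by (intro finite_measureI) simp
    then have "finite_measure \<mu>" unfolding \<mu>_def by (intro finite_measure.finite_measure_distr zm)
    moreover have "z -` (UNIV - ball 0 1) \<inter> space P = {}" using z by auto
    then have "emeasure \<mu> (UNIV - ball 0 1) = 0"
      unfolding \<mu>_def by (subst emeasure_distr) auto
    ultimately show ?thesis by (simp add: disc_measures_def \<mu>_def)
  qed
  moreover have "dual_norm_le_one \<phi> \<psi> (balayage \<mu>)"
    unfolding dual_norm_le_one_def
  proof (intro conjI ballI impI)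
    fix w assume w: "w \<in> orlicz_space \<phi>"
    have int: "integrable circle_measure (\<lambda>\<zeta>. c i * (poisson_kernel (z i) \<zeta> * w \<zeta>))" for i
      using integrable_poisson_kernel_mult[OF z orlicz_spaceD(3)[OF w]] by simp
    have eq: "(\<lambda>\<zeta>. balayage \<mu> \<zeta> * w \<zeta>) = (\<lambda>\<zeta>. \<Sum>i<n. c i * (poisson_kernel (z i) \<zeta> * w \<zeta>))"
      by (simp add: bal sum_distrib_right mult.assoc)
    show "integrable circle_measure (\<lambda>\<zeta>. balayage \<mu> \<zeta> * w \<zeta>)"
      unfolding eq using int by (intro Bochner_Integration.integrable_sum)
    assume norm: "orlicz_norm \<psi> w \<le> 1"
    have "\<bar>poisson_integral w (z i)\<bar> \<le> 2 * poisson_integral (\<lambda>\<zeta>. \<bar>w \<zeta>\<bar> / 2) (z i)" for i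
    proof -
      have "\<bar>poisson_integral w (z i)\<bar> \<le> (\<integral>\<zeta>. \<bar>poisson_kernel (z i) \<zeta> * w \<zeta>\<bar> \<partial>circle_measure)"
        unfolding poisson_integral_def by (rule integral_abs_bound)
      also have "\<dots> = 2 * poisson_integral (\<lambda>\<zeta>. \<bar>w \<zeta>\<bar> / 2) (z i)"
        using poisson_kernel_nonneg[OF z] by (simp add: poisson_integral_def abs_mult)
      finally show ?thesis .
    qed
    then have "(\<Sum>i<n. c i * \<bar>poisson_integral w (z i)\<bar>)
        \<le> (\<Sum>i<n. c i * (2 * poisson_integral (\<lambda>\<zeta>. \<bar>w \<zeta>\<bar> / 2) (z i)))"
      using c by (intro sum_mono mult_left_mono)
    also have "\<dots> = (\<Sum>i<n. l i * poisson_integral (\<lambda>\<zeta>. \<bar>w \<zeta>\<bar> / 2) (z i)) / S"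
      using S by (simp add: c_def sum_divide_distrib)
    also have "\<dots> \<le> 1" using le[OF orlicz_norm_le_oneD[OF w norm]] S by simp
    finally have "(\<Sum>i<n. c i * \<bar>poisson_integral w (z i)\<bar>) \<le> 1" .
    moreover have "(\<integral>\<zeta>. balayage \<mu> \<zeta> * w \<zeta> \<partial>circle_measure) = (\<Sum>i<n. c i * poisson_integral w (z i))"
      unfolding eq poisson_integral_def using int by (subst Bochner_Integration.integral_sum) auto
    moreover have "\<bar>\<Sum>i<n. c i * poisson_integral w (z i)\<bar> \<le> (\<Sum>i<n. c i * \<bar>poisson_integral w (z i)\<bar>)"
      using sum_abs[of "\<lambda>i. c i * poisson_integral w (z i)" "{..<n}"] c by (simp add: abs_mult)
    ultimately show "\<bar>\<integral>\<zeta>. balayage \<mu> \<zeta> * w \<zeta> \<partial>circle_measure\<bar> \<le> 1" by simp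
  qed
  ultimately have "\<mu> \<in> B_phi_star \<phi> \<psi>" by (simp add: B_phi_star_def)
  from C(2)[OF this] have "(\<integral>\<^sup>+ z. ennreal (u z) * indicator (ball 0 1) z \<partial>\<mu>) \<le> ennreal C" .
  also have "(\<integral>\<^sup>+ z. ennreal (u z) * indicator (ball 0 1) z \<partial>\<mu>)
      = (\<integral>\<^sup>+ i. ennreal (u (z i)) * indicator (ball 0 1) (z i) \<partial>P)"
  proof -
    \<comment> \<open>\<open>u\<close> is measurable only on the disc; the indicator makes it a
      Borel function on the plane, so that the integral can be pulled back along
      \<open>z\<close>.\<close>
    have "(\<lambda>z. ennreal (u z)) \<in> borel_measurable (restrict_space borel (ball 0 1))"
      using u(1) by measurable
    then have "(\<lambda>z. ennreal (u z) * indicator (ball 0 1) z) \<in> borel_measurable borel"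
      by (subst (asm) borel_measurable_restrict_space_iff_ennreal) auto
    then show ?thesis unfolding \<mu>_def by (subst nn_integral_distr) auto
  qed
  also have "\<dots> = ennreal (\<Sum>i<n. c i * u (z i))"
    using z c u(2)[OF z] by (simp add: P_def nn_integral_point_measure_finite sum_ennreal flip: ennreal_mult)
  finally have "(\<Sum>i<n. c i * u (z i)) \<le> C" using C(1) by (simp add: ennreal_le_iff)
  moreover have "(\<Sum>i<n. c i * u (z i)) = (\<Sum>i<n. l i * u (z i)) / (2 * S)"
    by (simp add: c_def sum_divide_distrib)
  ultimately show ?thesis using S by (simp add: field_simps)
qed

text \<open>As \<open>v\<close> runs through the modular ball, the vectors of values
  \<open>2 * C * poisson_integral v (z i)\<close> form a convex set, bounded in the first
  \<open>n\<close> coordinates. The bound for finite combinations is the dual bound that separation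
  needs.\<close>

lemma finite_majorant:
  fixes u :: "complex \<Rightarrow> real" and z :: "nat \<Rightarrow> complex"
  assumes u: "u \<in> borel_measurable (restrict_space borel (ball 0 1))" "\<And>z. z \<in> ball 0 1 \<Longrightarrow> 0 \<le> u z"
    and C: "0 < C" "\<And>\<mu>. \<mu> \<in> B_phi_star \<phi> \<psi> \<Longrightarrow> (\<integral>\<^sup>+ z. ennreal (u z) * indicator (ball 0 1) z \<partial>\<mu>) \<le> ennreal C"
    and z: "\<And>i. z i \<in> ball 0 1" and e: "0 < \<epsilon>"
  shows "\<exists>v\<in>modular_ball. \<forall>i<n. u (z i) - \<epsilon> \<le> 2 * C * poisson_integral v (z i)"
proof -
  define A where "A = (\<lambda>v i. 2 * C * poisson_integral v (z i)) ` modular_ball"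
  obtain B where B: "\<And>v. v \<in> modular_ball \<Longrightarrow> (\<integral>\<zeta>. v \<zeta> \<partial>circle_measure) \<le> B"
    using modular_ball_integral_bounded by blast
  define b where "b i = 2 * C * (B / (1 - cmod (z i))\<^sup>2)" for i
  have "\<exists>a\<in>A. \<forall>i<n. u (z i) - \<epsilon> \<le> a i"
  proof (rule coordinatewise_dominated_if_dual_bound[where B = "Max (insert 0 (b ` {..<n}))"])
    show "A \<noteq> {}" using modular_ball_zero by (auto simp: A_def)
  next
    fix a a' :: "nat \<Rightarrow> real" and t :: real
    assume "a \<in> A" "a' \<in> A" and t: "0 \<le> t" "t \<le> 1"
    then obtain v w where v: "v \<in> modular_ball" "a = (\<lambda>i. 2 * C * poisson_integral v (z i))"
      and w: "w \<in> modular_ball" "a' = (\<lambda>i. 2 * C * poisson_integral w (z i))" by (auto simp: A_def)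
    have P: "poisson_integral (\<lambda>\<zeta>. (1 - t) * v \<zeta> + t * w \<zeta>) (z i)
        = (1 - t) * poisson_integral v (z i) + t * poisson_integral w (z i)" for i
      using modular_ballD(3)[OF v(1)] modular_ballD(3)[OF w(1)]
      by (subst poisson_integral_add[OF z]) (auto simp only: poisson_integral_cmult intro!: integrable_mult_right)
    have "(\<lambda>i. (1 - t) * a i + t * a' i) = (\<lambda>i. 2 * C * poisson_integral (\<lambda>\<zeta>. (1 - t) * v \<zeta> + t * w \<zeta>) (z i))"
      unfolding v(2) w(2) P by (simp add: algebra_simps)
    then show "(\<lambda>i. (1 - t) * a i + t * a' i) \<in> A"
      unfolding A_def using modular_ball_convex[OF v(1) w(1) t] by blast
  next
    fix a i assume "a \<in> A" and i: "i < n"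
    then obtain v where v: "v \<in> modular_ball" "a = (\<lambda>i. 2 * C * poisson_integral v (z i))" by (auto simp: A_def)
    have "poisson_integral v (z i) \<le> (\<integral>\<zeta>. v \<zeta> \<partial>circle_measure) / (1 - cmod (z i))\<^sup>2"
      using modular_ballD(2,3)[OF v(1)] z by (intro poisson_integral_le)
    also have "\<dots> \<le> B / (1 - cmod (z i))\<^sup>2" using B[OF v(1)] by (intro divide_right_mono) auto
    finally have "a i \<le> b i" unfolding v(2) b_def using C(1) by (intro mult_left_mono) auto
    also have "b i \<le> Max (insert 0 (b ` {..<n}))" using i by (intro Max_ge) auto
    finally show "0 \<le> a i \<and> a i \<le> Max (insert 0 (b ` {..<n}))"
      using poisson_integral_nonneg[OF z modular_ballD(2)[OF v(1)]] C(1) by (simp add: v)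
  next
    fix l :: "nat \<Rightarrow> real" and S :: real
    assume l: "\<And>i. 0 \<le> l i" and S: "0 \<le> S" and le: "\<And>a. a \<in> A \<Longrightarrow> (\<Sum>i<n. l i * a i) \<le> S"
    show "(\<Sum>i<n. l i * u (z i)) \<le> S"
    \<comment> \<open>\<open>S\<close> may be 0, while the masses in the combination bound are
      divided by it; hence the passage through \<open>S + e\<close>.\<close>
    proof (rule field_le_epsilon)
      fix e :: real assume e: "0 < e"
      have "(\<Sum>i<n. l i * poisson_integral v (z i)) \<le> (S + e) / (2 * C)" if "v \<in> modular_ball" for v
      proof -
        have "(\<Sum>i<n. l i * (2 * C * poisson_integral v (z i))) \<le> S" using le that by (auto simp: A_def)
        also have "(\<Sum>i<n. l i * (2 * C * poisson_integral v (z i))) = 2 * C * (\<Sum>i<n. l i * poisson_integral v (z i))"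
          by (simp add: sum_distrib_left mult_ac)
        finally show ?thesis using C(1) e by (simp add: field_simps)
      qed
      then have "(\<Sum>i<n. l i * u (z i)) \<le> 2 * ((S + e) / (2 * C)) * C"
        using C S e by (intro finite_combination_bound[OF u _ _ z l]) auto
      then show "(\<Sum>i<n. l i * u (z i)) \<le> S + e" using C(1) by simp
    qed
  qed (rule e)
  then show ?thesis by (auto simp: A_def)
qed

text \<open>At stage \<open>n\<close> the first \<open>n\<close> inequalities are imposed up to
  \<open>1 / Suc n\<close>. The resulting convex sets are nonempty and decreasing, so suitable
  members converge almost everywhere along a subsequence; uniform integrability carries each
  inequality to the limit, where the tolerance has vanished.\<close>

lemma countable_majorant:
  fixes u :: "complex \<Rightarrow> real" and z :: "nat \<Rightarrow> complex"
  assumes u: "u \<in> borel_measurable (restrict_space borel (ball 0 1))" "\<And>z. z \<in> ball 0 1 \<Longrightarrow> 0 \<le> u z"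
    and C: "0 < C" "\<And>\<mu>. \<mu> \<in> B_phi_star \<phi> \<psi> \<Longrightarrow> (\<integral>\<^sup>+ z. ennreal (u z) * indicator (ball 0 1) z \<partial>\<mu>) \<le> ennreal C"
    and z: "\<And>i. z i \<in> ball 0 1"
  shows "\<exists>v\<in>modular_ball. \<forall>i. u (z i) \<le> 2 * C * poisson_integral v (z i)"
proof -
  define K where "K n = {v \<in> modular_ball. \<forall>i<n. u (z i) - 1 / Suc n \<le> 2 * C * poisson_integral v (z i)}" for n
  obtain f r where f: "\<And>n. f n \<in> K n" and r: "strict_mono (r :: nat \<Rightarrow> nat)"
    and Cau: "AE \<zeta> in circle_measure. Cauchy (\<lambda>n. exp (- f (r n) \<zeta> / 2))"
  proof (rule circle.decreasing_convex_sets_AE_Cauchy[of K])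
    show "K n \<noteq> {}" for n using finite_majorant[of u C z "1 / Suc n" n, OF u C z] by (auto simp: K_def)
    show "K n \<subseteq> K m" if "m \<le> n" for m n
    proof -
      have "1 / real (Suc n) \<le> 1 / Suc m" using that by (intro divide_left_mono) auto
      then have "u (z i) - 1 / Suc m \<le> u (z i) - 1 / Suc n" for i by simp
      from order_trans[OF this] show ?thesis using that unfolding K_def by auto
    qed
    show "(\<lambda>x. (g x + h x) / 2) \<in> K n" if g: "g \<in> K n" and h: "h \<in> K n" for n g h
    proof -
      have gh: "g \<in> modular_ball" "h \<in> modular_ball" using g h by (auto simp: K_def)
      have eq: "(\<lambda>x. (g x + h x) / 2) = (\<lambda>x. (1 - 1/2) * g x + 1/2 * h x)" by (simp add: field_simps)
      have P: "poisson_integral (\<lambda>x. (1 - 1/2) * g x + 1/2 * h x) (z i)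
        = (1 - 1/2) * poisson_integral g (z i) + 1/2 * poisson_integral h (z i)" for i
        using modular_ballD(3)[OF gh(1)] modular_ballD(3)[OF gh(2)]
        by (subst poisson_integral_add[OF z]) (auto simp only: poisson_integral_cmult intro!: integrable_mult_right)
      have "u (z i) - 1 / Suc n \<le> 2 * C * poisson_integral (\<lambda>x. (1 - 1/2) * g x + 1/2 * h x) (z i)" if "i < n" for i
      proof -
        have "u (z i) - 1 / Suc n \<le> 2 * C * poisson_integral g (z i)"
          "u (z i) - 1 / Suc n \<le> 2 * C * poisson_integral h (z i)"
          using that g h by (auto simp: K_def)
        then show ?thesis unfolding P by (simp add: algebra_simps)
      qed
      then show ?thesis using modular_ball_convex[OF gh, of "1/2"] unfolding eq K_def by simp
    qed
  qed (auto simp: K_def modular_ballD cong: measurable_cong_sets)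
  have fK: "f n \<in> modular_ball" for n using f by (auto simp: K_def)
  obtain v where v: "v \<in> modular_ball" "AE \<zeta> in circle_measure. (\<lambda>n. f (r n) \<zeta>) \<longlonglongrightarrow> v \<zeta>"
    using modular_ball_AE_limit[of "\<lambda>n. f (r n)", OF fK Cau] by blast
  have "u (z i) \<le> 2 * C * poisson_integral v (z i)" for i
  proof -
    have "(\<lambda>n. (u (z i) - 1 / Suc (r n)) / (2 * C)) \<longlonglongrightarrow> (u (z i) - 0) / (2 * C)"
      using C(1) LIMSEQ_subseq_LIMSEQ[OF LIMSEQ_Suc[OF lim_1_over_n] r]
      by (intro tendsto_intros) (auto simp: o_def)
    moreover have "(u (z i) - 1 / Suc (r n)) / (2 * C) \<le> poisson_integral (f (r n)) (z i)" if "n \<ge> Suc i" for n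
    proof -
      \<comment> \<open>A strictly increasing \<open>r\<close> satisfies \<open>n \<le> r n\<close>,
        so the constraint at \<open>z i\<close> is in force from \<open>Suc i\<close> on.\<close>
      have "i < r n" using seq_suble[OF r, of n] that by simp
      then have "u (z i) - 1 / Suc (r n) \<le> 2 * C * poisson_integral (f (r n)) (z i)"
        using f[of "r n"] by (auto simp: K_def)
      then show ?thesis using C(1) by (subst pos_divide_le_eq) (auto simp: mult.commute)
    qed
    ultimately have "(u (z i) - 0) / (2 * C) \<le> poisson_integral v (z i)"
      by (rule poisson_integral_limit_ge[OF fK v z])
    then show ?thesis using C(1) by (simp add: field_simps)
  qed
  with v(1) show ?thesis by blast
qed

text \<open>\<open>Delta2\<close> with equal arguments is a doubling inequality, which is iterated.
  The additive constant absorbs arguments below \<open>t0\<close>, where monotonicity bounds the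
  value.\<close>

lemma Delta2_scale:
  assumes "Delta2 \<phi>"
  shows "\<exists>a\<ge>0. \<exists>b\<ge>0. \<forall>t\<ge>0. \<phi> (2 ^ n * t) \<le> a * \<phi> t + b"
proof (induction n)
  case 0
  show ?case by (intro exI[of _ 1] conjI exI[of _ 0]) auto
next
  case (Suc n)
  then obtain a b where ab: "0 \<le> a" "0 \<le> b" "\<And>t. 0 \<le> t \<Longrightarrow> \<phi> (2 ^ n * t) \<le> a * \<phi> t + b" by blast
  obtain c t0 where c: "1 \<le> c" "\<And>x y. t0 \<le> x \<Longrightarrow> t0 \<le> y \<Longrightarrow> \<phi> (x + y) \<le> c * (\<phi> x + \<phi> y)"
    using assms by (auto simp: Delta2_def)
  have double: "\<phi> (2 * t) \<le> 2 * c * \<phi> t + \<phi> (2 * t0)" for t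
  proof (cases "t0 \<le> t")
    case True
    then show ?thesis using c(2)[of t t] phi_nonneg[of "2 * t0"] by simp
  next
    case False
    then have "\<phi> (2 * t) \<le> \<phi> (2 * t0)" by (intro monoD[OF phi_mono]) simp
    then show ?thesis using c(1) phi_nonneg[of t] by (simp add: add_increasing)
  qed
  have "\<phi> (2 ^ Suc n * t) \<le> (2 * c * a) * \<phi> t + (2 * c * b + \<phi> (2 * t0))" if "0 \<le> t" for t
  proof -
    have "\<phi> (2 ^ Suc n * t) \<le> 2 * c * \<phi> (2 ^ n * t) + \<phi> (2 * t0)"
      using double[of "2 ^ n * t"] by (simp add: mult.assoc)
    also have "\<dots> \<le> 2 * c * (a * \<phi> t + b) + \<phi> (2 * t0)"
      using ab(3)[OF that] c(1) by (intro add_right_mono mult_left_mono) auto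
    finally show ?thesis by (simp add: algebra_simps)
  qed
  then show ?case using ab c(1) phi_nonneg
    by (intro exI[of _ "2 * c * a"] conjI exI[of _ "2 * c * b + \<phi> (2 * t0)"]) auto
qed

text \<open>With a power of two above \<open>c\<close>, \<open>Delta2\<close> bounds
  \<open>\<phi> (c * v \<zeta>)\<close> by an affine function of \<open>\<phi> (v \<zeta>)\<close>,
  hence of the integrable \<open>\<psi> (v \<zeta>)\<close>.\<close>

lemma modular_ball_scale_in_orlicz_space:
  assumes D: "Delta2 \<phi>" and v: "v \<in> modular_ball" and c: "0 \<le> c"
  shows "(\<lambda>\<zeta>. c * v \<zeta>) \<in> orlicz_space \<phi>"
proof -
  note [measurable] = modular_ballD(1)[OF v]
  obtain n :: nat where n: "c < 2 ^ n" using real_arch_pow[of 2 c] by auto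
  obtain a b where ab: "0 \<le> a" "0 \<le> b" "\<And>t. 0 \<le> t \<Longrightarrow> \<phi> (2 ^ n * t) \<le> a * \<phi> t + b"
    using Delta2_scale[OF D, of n] by blast
  obtain B where B: "0 \<le> B" "\<And>t. 0 \<le> t \<Longrightarrow> \<phi> t \<le> \<psi> t + B" using phi_psi_close by auto
  have le: "\<phi> (c * v \<zeta>) \<le> a * (\<psi> (v \<zeta>) + B) + b" for \<zeta>
  proof -
    have v0: "0 \<le> v \<zeta>" using modular_ballD(2)[OF v] .
    have "\<phi> (c * v \<zeta>) \<le> \<phi> (2 ^ n * v \<zeta>)" using n v0 by (intro monoD[OF phi_mono] mult_right_mono) auto
    also have "\<dots> \<le> a * \<phi> (v \<zeta>) + b" using ab(3)[OF v0] .
    also have "\<dots> \<le> a * (\<psi> (v \<zeta>) + B) + b" using B(2)[OF v0] ab(1) by (intro add_right_mono mult_left_mono)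
    finally show ?thesis .
  qed
  have "integrable circle_measure (\<lambda>\<zeta>. \<phi> (c * v \<zeta>))"
  proof (rule integrable_nonneg_le)
    show "integrable circle_measure (\<lambda>\<zeta>. a * (\<psi> (v \<zeta>) + B) + b)" using modular_ballD(4)[OF v] by simp
  qed (auto simp: phi_nonneg le)
  then show ?thesis using c modular_ballD(2)[OF v] by (simp add: orlicz_space_def abs_mult)
qed

lemma majorant_exists:
  fixes u :: "complex \<Rightarrow> real"
  assumes D: "Delta2 \<phi>"
    and u: "u \<in> borel_measurable (restrict_space borel (ball 0 1))" "\<And>z. z \<in> ball 0 1 \<Longrightarrow> 0 \<le> u z"
    and C: "0 < C" "\<And>\<mu>. \<mu> \<in> B_phi_star \<phi> \<psi> \<Longrightarrow> (\<integral>\<^sup>+ z. ennreal (u z) * indicator (ball 0 1) z \<partial>\<mu>) \<le> ennreal C"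
  shows "\<exists>w\<in>orlicz_space \<phi>. \<forall>z\<in>ball 0 1. u z \<le> poisson_integral w z"
proof -
  \<comment> \<open>\<open>u\<close> need not be semicontinuous, so the test points must be dense in its graph, not just in the disc.\<close>
  define \<Gamma> where "\<Gamma> = (\<lambda>z. (z, u z)) ` ball 0 1"
  obtain T where T: "countable T" "T \<subseteq> \<Gamma>" "\<Gamma> \<subseteq> closure T" by (rule separable)
  have "T \<noteq> {}" using T(3) by (auto simp: \<Gamma>_def)
  define z where "z i = fst (from_nat_into T i)" for i
  have in_T: "from_nat_into T i \<in> T" for i using \<open>T \<noteq> {}\<close> by (rule from_nat_into)
  have z: "z i \<in> ball 0 1" for i using in_T[of i] T(2) unfolding z_def \<Gamma>_def by force
  obtain v where v: "v \<in> modular_ball" "\<And>i. u (z i) \<le> 2 * C * poisson_integral v (z i)"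
    using countable_majorant[of u C z, OF u C z] by blast
  define w where "w \<zeta> = 2 * C * v \<zeta>" for \<zeta>
  have w: "w \<in> orlicz_space \<phi>"
    unfolding w_def using C(1) by (intro modular_ball_scale_in_orlicz_space D v) auto
  have Pw: "poisson_integral w x = 2 * C * poisson_integral v x" for x
    unfolding w_def by (rule poisson_integral_cmult)
  have on_T: "snd p \<le> poisson_integral w (fst p)" if "p \<in> T" for p
  proof -
    obtain i where i: "from_nat_into T i = p" using from_nat_into_surj[OF T(1) \<open>p \<in> T\<close>] by blast
    have "snd p = u (fst p)" using that T(2) by (auto simp: \<Gamma>_def)
    then show ?thesis using v(2)[of i] i by (simp add: Pw z_def)
  qed
  have "u x \<le> poisson_integral w x" if x: "x \<in> ball 0 1" for x
  proof -
    have "(x, u x) \<in> closure T" using T(3) x by (auto simp: \<Gamma>_def)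
    \<comment> \<open>Convergence in the graph moves points and values together, so the inequality
      on \<open>T\<close> passes to \<open>x\<close> by continuity of the Poisson integral
      alone.\<close>
    then obtain s where s: "\<And>k. s k \<in> T" "s \<longlonglongrightarrow> (x, u x)" by (auto simp: closure_sequential)
    show ?thesis
    proof (rule LIMSEQ_le)
      show "(\<lambda>k. snd (s k)) \<longlonglongrightarrow> u x" using tendsto_snd[OF s(2)] by simp
      show "(\<lambda>k. poisson_integral w (fst (s k))) \<longlonglongrightarrow> poisson_integral w x"
        using tendsto_fst[OF s(2)] by (intro tendsto_poisson_integral x orlicz_spaceD(3)[OF w]) simp
      show "\<exists>N. \<forall>k\<ge>N. snd (s k) \<le> poisson_integral w (fst (s k))" using on_T s(1) by blast
    qed
  qed
  with w show ?thesis by blast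
qed

end

section \<open>The equivalence of (a) and (b)\<close>

theorem theorem1p2:
  fixes \<phi> \<psi> :: "real \<Rightarrow> real" and u :: "complex \<Rightarrow> real"
  assumes "strongly_convex \<phi>" and "Delta2 \<phi>" and "Nabla2 \<phi>"
    and "modification_of \<psi> \<phi>"
    and "u \<in> borel_measurable (restrict_space borel (ball 0 1))"
    and "\<forall>z \<in> ball 0 1. 0 \<le> u z"
  shows "(\<exists>w \<in> orlicz_space \<phi>. \<forall>z \<in> ball 0 1. u z \<le> poisson_integral w z)
     \<longleftrightarrow> (\<exists>C\<ge>0. \<forall>\<mu> \<in> B_phi_star \<phi> \<psi>.
            (\<integral>\<^sup>+ z. ennreal (u z) * indicator (ball 0 1) z \<partial>\<mu>) \<le> ennreal C)"
proof -
  interpret orlicz_pair \<phi> \<psi> using assms by unfold_locales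
  show ?thesis
  proof
    assume "\<exists>w \<in> orlicz_space \<phi>. \<forall>z \<in> ball 0 1. u z \<le> poisson_integral w z"
    then obtain w where w: "w \<in> orlicz_space \<phi>" "\<And>z. z \<in> ball 0 1 \<Longrightarrow> u z \<le> poisson_integral w z" by blast
    obtain C where C: "0 \<le> C" "\<And>\<mu>. \<mu> \<in> B_phi_star \<phi> \<psi> \<Longrightarrow>
        (\<integral>\<^sup>+ z. ennreal (poisson_integral w z) * indicator (ball 0 1) z \<partial>\<mu>) \<le> ennreal C"
      using balayage_bound[OF w(1)] by blast
    have "(\<integral>\<^sup>+ z. ennreal (u z) * indicator (ball 0 1) z \<partial>\<mu>)
        \<le> (\<integral>\<^sup>+ z. ennreal (poisson_integral w z) * indicator (ball 0 1) z \<partial>\<mu>)" for \<mu>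
      using w(2) by (intro nn_integral_mono) (auto simp: ennreal_leI split: split_indicator)
    from order_trans[OF this C(2)] C(1) show "\<exists>C\<ge>0. \<forall>\<mu> \<in> B_phi_star \<phi> \<psi>.
        (\<integral>\<^sup>+ z. ennreal (u z) * indicator (ball 0 1) z \<partial>\<mu>) \<le> ennreal C"
      by blast
  next
    assume "\<exists>C\<ge>0. \<forall>\<mu> \<in> B_phi_star \<phi> \<psi>.
        (\<integral>\<^sup>+ z. ennreal (u z) * indicator (ball 0 1) z \<partial>\<mu>) \<le> ennreal C"
    then obtain C where "\<And>\<mu>. \<mu> \<in> B_phi_star \<phi> \<psi> \<Longrightarrow>
        (\<integral>\<^sup>+ z. ennreal (u z) * indicator (ball 0 1) z \<partial>\<mu>) \<le> ennreal C" by blast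
    \<comment> \<open>Raising the constant to at least 1 provides the strict positivity by which the
      construction of the majorant divides.\<close>
    then have "(\<integral>\<^sup>+ z. ennreal (u z) * indicator (ball 0 1) z \<partial>\<mu>) \<le> ennreal (max 1 C)"
      if "\<mu> \<in> B_phi_star \<phi> \<psi>" for \<mu>
      by (rule order_trans) (use that in \<open>auto intro: ennreal_leI\<close>)
    then show "\<exists>w \<in> orlicz_space \<phi>. \<forall>z \<in> ball 0 1. u z \<le> poisson_integral w z"
      using assms by (intro majorant_exists[where C = "max 1 C"]) auto
  qed
qed

end
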